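(* Let $\mathbb{G}$ be a totally ordered Abelian group with $\operatorname{Deg}(\mathbb{G})=\kappa$. For any space $X$ the following are equivalent: (a) $X$ is $\mathbb{G}$-Polish; (b) $X$ is a $\kappa$-additive $f\mathrm{SC}_\kappa$-space; (c) $X$ is homeomorphic to a $G^\kappa_\delta$ subset of ${}^{\kappa}\kappa$; (d) $X$ is homeomorphic to a closed subset of ${}^{\kappa}\kappa$.
   Context: Work in ZFC; $\kappa$ is an uncountable regular cardinal with $2^{<\kappa}=\kappa$ (equivalently $\kappa^{<\kappa}=\kappa$). "Space" means regular Hausdorff topological space. ${}^{\kappa}\kappa$ is the set of all functions $\kappa\to\kappa$ with the bounded topology, generated by the sets $\{x\in{}^{\kappa}\kappa \mid s\subseteq x\}$, $s\in{}^{<\kappa}\kappa$. A space is $\kappa$-additive if its topology is closed under intersections of fewer than $\kappa$ open sets. A $G^\kappa_\delta$ set is an intersection of $\kappa$-many open sets (repetitions allowed). Strong fair $\kappa$-Choquet game $f\mathrm{G}^s_\kappa(X)$: players I and II play $\kappa$-many rounds. In round $\alpha<\kappa$, I plays $(U_\alpha,x_\alpha)$ with $U_\alpha$ a relatively open subset of $\bigcap_{\beta<\alpha}V_\beta$ (which is $X$ if $\alpha=0$) and $x_\alpha\in U_\alpha$; then II plays a relatively open subset $V_\alpha$ of $\bigcap_{\beta<\alpha}V_\beta$ with $x_\alpha\in V_\alpha\subseteq U_\alpha$. If $\bigcap_{\alpha<\gamma}V_\alpha=\emptyset$ for some limit $\gamma<\kappa$, the run ends and II wins. If the run lasts $\kappa$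 rounds, II wins iff $\bigcap_{\alpha<\kappa}V_\alpha\neq\emptyset$. $X$ is an $f\mathrm{SC}_\kappa$-space if it has weight $\le\kappa$ and II has a winning strategy in $f\mathrm{G}^s_\kappa(X)$. (The empty space, where I has no legal move, counts as such.) For a totally ordered (with translation-invariant linear order) Abelian group $\mathbb{G}$, $\mathbb{G}^+=\{\varepsilon\in\mathbb{G}\mid 0<\varepsilon\}$ and $\operatorname{Deg}(\mathbb{G})$ is the coinitiality of $\mathbb{G}^+$. A $\mathbb{G}$-metric on $X$ is a map $d\colon X^2\to\mathbb{G}^+\cup\{0\}$ with $d(x,y)=0\iff x=y$, $d(x,y)=d(y,x)$, $d(x,z)\le d(x,y)+d(y,z)$; its topology is generated by the balls $B_d(x,\varepsilon)=\{y\mid d(x,y)<\varepsilon\}$, $\varepsilon\in\mathbb{G}^+$, and $d$ is compatible with a topology if it generates it. $d$ is Cauchy-complete if every $d$-Cauchy sequence of length $\kappa$ converges. $X$ is $\mathbb{G}$-Polish if it has weight $\le\kappa$ and admits a compatible Cauchy-complete $\mathbb{G}$-metric. *)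

theory Defs
  imports "HOL-Analysis.Analysis"
begin

unbundle cardinal_syntax

section \<open>The cardinal\<close>

text \<open>
  The cardinal \<open>\<kappa>\<close> is the order type of a type \<open>'k :: wellorder\<close>: elements of \<open>'k\<close> are the
  ordinals below \<open>\<kappa>\<close>, and \<open>{..<\<alpha>}\<close> is the ordinal \<open>\<alpha>\<close>. That this order is an initial ordinal
  is the condition \<open>Card_order kappa\<close>. Functions from \<open>\<kappa>\<close> to \<open>\<kappa>\<close> are then functions on \<open>'k\<close>.
\<close>

definition kappa :: "'k::wellorder rel" where
  "kappa = {(\<alpha>, \<beta>). \<alpha> \<le> \<beta>}"

text \<open>\<open>2\<close> to the power \<open><\<kappa>\<close>: the binary sequences of length \<open>\<alpha>\<close>, for all \<open>\<alpha> < \<kappa>\<close>.\<close>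

definition binary_seqs_below :: "('k::wellorder \<times> ('k \<Rightarrow> bool)) set" where
  "binary_seqs_below = (SIGMA \<alpha>:UNIV. {..<\<alpha>} \<rightarrow>\<^sub>E UNIV)"

definition uncountable_regular_strong :: "'k::wellorder itself \<Rightarrow> bool" where
  "uncountable_regular_strong _ \<longleftrightarrow>
     Card_order (kappa :: 'k rel) \<and>
     natLeq <o (kappa :: 'k rel) \<and>
     regularCard (kappa :: 'k rel) \<and>
     |binary_seqs_below :: ('k \<times> ('k \<Rightarrow> bool)) set| =o (kappa :: 'k rel)"

definition limit_ord :: "'k::wellorder \<Rightarrow> bool" where
  "limit_ord \<gamma> \<longleftrightarrow> (\<exists>\<beta>. \<beta> < \<gamma>) \<and> (\<forall>\<beta><\<gamma>. \<exists>\<delta>. \<beta> < \<delta> \<and> \<delta> < \<gamma>)"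


section \<open>Topological notions\<close>

definition weight_le :: "'x topology \<Rightarrow> 'b rel \<Rightarrow> bool" where
  "weight_le X r \<longleftrightarrow>
     (\<exists>\<B>. |\<B>| \<le>o r \<and> (\<forall>V\<in>\<B>. openin X V) \<and>
          (\<forall>U x. openin X U \<and> x \<in> U \<longrightarrow> (\<exists>V\<in>\<B>. x \<in> V \<and> V \<subseteq> U)))"

definition additive_space :: "'b rel \<Rightarrow> 'x topology \<Rightarrow> bool" where
  "additive_space r X \<longleftrightarrow>
     (\<forall>\<U>. |\<U>| <o r \<and> (\<forall>U\<in>\<U>. openin X U) \<longrightarrow> openin X (topspace X \<inter> \<Inter>\<U>))"

text \<open>Each sequence of length \<open>\<alpha>\<close> is given as the restriction to \<open>{..<\<alpha>}\<close> of a total \<open>s\<close>.\<close>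

definition bounded_topology :: "('k::wellorder \<Rightarrow> 'k) topology" where
  "bounded_topology = topology_generated_by {{x. \<forall>\<beta><\<alpha>. x \<beta> = s \<beta>} | \<alpha> s. True}"

definition Gdelta_kappa :: "'k::wellorder itself \<Rightarrow> 'x topology \<Rightarrow> 'x set \<Rightarrow> bool" where
  "Gdelta_kappa _ X S \<longleftrightarrow> (\<exists>U :: 'k \<Rightarrow> 'x set. (\<forall>\<alpha>. openin X (U \<alpha>)) \<and> S = (\<Inter>\<alpha>. U \<alpha>))"


section \<open>The strong fair Choquet game\<close>

text \<open>
  The moves of I are given by \<open>p\<close>, where \<open>p \<alpha> = (U\<^sub>\<alpha>, x\<^sub>\<alpha>)\<close>, and those of II by \<open>V\<close>. The set
  \<open>game_arena X V \<alpha>\<close> is the space left at the beginning of round \<open>\<alpha>\<close>.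
\<close>

definition game_arena :: "'x topology \<Rightarrow> ('k::wellorder \<Rightarrow> 'x set) \<Rightarrow> 'k \<Rightarrow> 'x set" where
  "game_arena X V \<alpha> = topspace X \<inter> (\<Inter>\<beta>\<in>{..<\<alpha>}. V \<beta>)"

definition legal_I ::
  "'x topology \<Rightarrow> ('k::wellorder \<Rightarrow> 'x set \<times> 'x) \<Rightarrow> ('k \<Rightarrow> 'x set) \<Rightarrow> 'k \<Rightarrow> bool" where
  "legal_I X p V \<alpha> \<longleftrightarrow>
     openin (subtopology X (game_arena X V \<alpha>)) (fst (p \<alpha>)) \<and> snd (p \<alpha>) \<in> fst (p \<alpha>)"

definition legal_II ::
  "'x topology \<Rightarrow> ('k::wellorder \<Rightarrow> 'x set \<times> 'x) \<Rightarrow> ('k \<Rightarrow> 'x set) \<Rightarrow> 'k \<Rightarrow> bool" where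
  "legal_II X p V \<alpha> \<longleftrightarrow>
     openin (subtopology X (game_arena X V \<alpha>)) (V \<alpha>) \<and> snd (p \<alpha>) \<in> V \<alpha> \<and> V \<alpha> \<subseteq> fst (p \<alpha>)"

definition ended_by :: "'x topology \<Rightarrow> ('k::wellorder \<Rightarrow> 'x set) \<Rightarrow> 'k \<Rightarrow> bool" where
  "ended_by X V \<alpha> \<longleftrightarrow> (\<exists>\<gamma>\<le>\<alpha>. limit_ord \<gamma> \<and> game_arena X V \<gamma> = {})"

definition II_wins :: "'x topology \<Rightarrow> ('k::wellorder \<Rightarrow> 'x set) \<Rightarrow> bool" where
  "II_wins X V \<longleftrightarrow> (\<exists>\<gamma>. ended_by X V \<gamma>) \<or> (\<Inter>\<alpha>. V \<alpha>) \<noteq> {}"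

text \<open>
  In round \<open>\<alpha>\<close> a strategy of II sees the moves of I in rounds \<open>\<le> \<alpha>\<close> and those of II in rounds
  \<open>< \<alpha>\<close>. It is winning if, whenever II follows it, II moves legally as long as I has done so, and
  II wins every run in which I moves legally until the run ends. A run ended at a limit is
  continued arbitrarily; the moves from that limit on are irrelevant.
\<close>

definition winning_strategy_II ::
  "'x topology \<Rightarrow>
   ('k::wellorder \<Rightarrow> ('k \<Rightarrow> 'x set \<times> 'x) \<Rightarrow> ('k \<Rightarrow> 'x set) \<Rightarrow> 'x set) \<Rightarrow> bool" where
  "winning_strategy_II X \<sigma> \<longleftrightarrow>
     (\<forall>p V. (\<forall>\<alpha>. V \<alpha> = \<sigma> \<alpha> (restrict p {..\<alpha>}) (restrict V {..<\<alpha>})) \<longrightarrow>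
        (\<forall>\<alpha>. (\<forall>\<beta>\<le>\<alpha>. legal_I X p V \<beta>) \<longrightarrow> legal_II X p V \<alpha>) \<and>
        ((\<forall>\<alpha>. \<not> ended_by X V \<alpha> \<longrightarrow> legal_I X p V \<alpha>) \<longrightarrow> II_wins X V))"

definition fSC_space :: "'k::wellorder itself \<Rightarrow> 'x topology \<Rightarrow> bool" where
  "fSC_space _ X \<longleftrightarrow>
     weight_le X (kappa :: 'k rel) \<and>
     (\<exists>\<sigma> :: 'k \<Rightarrow> ('k \<Rightarrow> 'x set \<times> 'x) \<Rightarrow> ('k \<Rightarrow> 'x set) \<Rightarrow> 'x set. winning_strategy_II X \<sigma>)"


section \<open>Metrics with values in an ordered group\<close>

definition coinitial_in :: "'a::linorder set \<Rightarrow> 'a set \<Rightarrow> bool" where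
  "coinitial_in B A \<longleftrightarrow> B \<subseteq> A \<and> (\<forall>a\<in>A. \<exists>b\<in>B. b \<le> a)"

definition has_coinitiality :: "'a::linorder set \<Rightarrow> 'b rel \<Rightarrow> bool" where
  "has_coinitiality A r \<longleftrightarrow>
     (\<exists>B. coinitial_in B A \<and> |B| =o r) \<and> (\<forall>B. coinitial_in B A \<longrightarrow> r \<le>o |B| )"

definition has_Deg :: "'g::linordered_ab_group_add itself \<Rightarrow> 'b rel \<Rightarrow> bool" where
  "has_Deg _ r \<longleftrightarrow> has_coinitiality {\<epsilon>::'g. 0 < \<epsilon>} r"

definition group_metric_on :: "'x set \<Rightarrow> ('x \<Rightarrow> 'x \<Rightarrow> 'g::linordered_ab_group_add) \<Rightarrow> bool" where
  "group_metric_on M d \<longleftrightarrow>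
     (\<forall>x\<in>M. \<forall>y\<in>M. 0 \<le> d x y \<and> (d x y = 0 \<longleftrightarrow> x = y) \<and> d x y = d y x) \<and>
     (\<forall>x\<in>M. \<forall>y\<in>M. \<forall>z\<in>M. d x z \<le> d x y + d y z)"

definition group_metric_topology ::
  "'x set \<Rightarrow> ('x \<Rightarrow> 'x \<Rightarrow> 'g::linordered_ab_group_add) \<Rightarrow> 'x topology" where
  "group_metric_topology M d = topology_generated_by {{y\<in>M. d x y < \<epsilon>} | x \<epsilon>. x \<in> M \<and> 0 < \<epsilon>}"

definition group_Cauchy ::
  "('x \<Rightarrow> 'x \<Rightarrow> 'g::linordered_ab_group_add) \<Rightarrow> ('k::wellorder \<Rightarrow> 'x) \<Rightarrow> bool" where
  "group_Cauchy d s \<longleftrightarrow> (\<forall>\<epsilon>>0. \<exists>\<alpha>. \<forall>\<beta>\<ge>\<alpha>. \<forall>\<gamma>\<ge>\<alpha>. d (s \<beta>) (s \<gamma>) < \<epsilon>)"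

definition Cauchy_complete_on ::
  "'k::wellorder itself \<Rightarrow> 'x set \<Rightarrow> ('x \<Rightarrow> 'x \<Rightarrow> 'g::linordered_ab_group_add) \<Rightarrow> bool" where
  "Cauchy_complete_on _ M d \<longleftrightarrow>
     (\<forall>s :: 'k \<Rightarrow> 'x. range s \<subseteq> M \<and> group_Cauchy d s \<longrightarrow>
        (\<exists>l. limitin (group_metric_topology M d) s l at_top))"

definition group_Polish ::
  "'k::wellorder itself \<Rightarrow> 'g::linordered_ab_group_add itself \<Rightarrow> 'x topology \<Rightarrow> bool" where
  "group_Polish k _ X \<longleftrightarrow>
     weight_le X (kappa :: 'k rel) \<and>
     (\<exists>d :: 'x \<Rightarrow> 'x \<Rightarrow> 'g.
        group_metric_on (topspace X) d \<and>
        group_metric_topology (topspace X) d = X \<and>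
        Cauchy_complete_on k (topspace X) d)"

end

theory Submission
  imports Defs
begin

text \<open>
  The proof is a cycle: a complete metric gives \<open>\<kappa>\<close>-additivity and a winning strategy, these give an
  embedding of \<open>X\<close> with closed image into the space of functions from \<open>\<kappa>\<close> to \<open>\<kappa>\<close>, and such an embedding gives a
  complete metric. Separately, closed and \<open>G\<^sup>\<kappa>\<^sub>\<delta>\<close> images are interchangeable.

  From the metric to the game: since the positive elements of the group have coinitiality \<open>\<kappa>\<close>, fewer than
  \<open>\<kappa>\<close> positive radii have a common positive lower bound, which gives \<open>\<kappa>\<close>-additivity. Player II wins by
  answering with balls whose radii are coinitial and whose closed balls are inside the sets played by I;
  completeness gives a point in all of them (\<open>group_Polish_imp_additive_fSC\<close>).

  From the game to a closed set: this is the main part. A regular \<open>\<kappa>\<close>-additive space of weight at most \<open>\<kappa>\<close> has a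
  base of clopen sets \<open>Z \<alpha>\<close> with \<open>\<alpha> < \<kappa>\<close>. Organize runs of the game, in which II follows a winning strategy, into
  a tree whose levels partition \<open>X\<close> into open sets: a node \<open>C\<close> of level \<open>\<alpha>\<close> is partitioned into open sets that
  are contained in replies of II to moves of I inside \<open>C\<close>, and I plays so that each reply is inside \<open>Z \<alpha>\<close> or
  disjoint from it. At limits take intersections, which are open by additivity. A branch without empty node
  is a run that is not ended at a limit, so II wins it and the branch has a common point. This point is unique, as
  the branch decides all \<open>Z \<alpha>\<close> and these separate points. So \<open>X\<close> is homeomorphic to the set of branches without
  empty node, and this set is closed in the space of functions from \<open>\<kappa>\<close> to \<open>\<kappa>\<close> (\<open>fSC_imp_closed_embedding\<close>).

  From a closed set to the metric: measure the first difference of two functions by a decreasing coinitial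
  family of positive elements (\<open>closed_embedding_imp_group_Polish\<close>).

  From a \<open>G\<^sup>\<kappa>\<^sub>\<delta>\<close> set to a closed set: a \<open>G\<^sup>\<kappa>\<^sub>\<delta>\<close> set is homeomorphic to the graph of the function that sends a
  point to witnesses of its membership in each of the open sets, and this graph is closed
  (\<open>Gdelta_embedding_imp_closed_embedding\<close>). Closed sets are \<open>G\<^sup>\<kappa>\<^sub>\<delta>\<close>, as in metric spaces.
\<close>

section \<open>Cardinal arithmetic below \<open>\<kappa>\<close>\<close>

locale strong_cardinal =
  fixes k :: "'k::wellorder itself"
  assumes strong: "uncountable_regular_strong k"
begin

lemma kappa_Card_order: "Card_order (kappa :: 'k rel)"
  using strong by (simp add: uncountable_regular_strong_def)

lemma Field_kappa [simp]: "Field (kappa :: 'k rel) = UNIV"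
  by (auto simp: kappa_def Field_def)

lemma kappa_eq_card_UNIV: "(kappa :: 'k rel) =o |UNIV :: 'k set|"
  using card_of_Field_ordIso[OF kappa_Card_order] by (simp add: ordIso_symmetric)

lemma infinite_UNIV_kappa: "infinite (UNIV :: 'k set)"
proof -
  have "natLeq \<le>o (kappa :: 'k rel)"
    using strong ordLess_imp_ordLeq by (auto simp: uncountable_regular_strong_def)
  then have "natLeq \<le>o |UNIV :: 'k set|"
    using kappa_eq_card_UNIV ordLeq_ordIso_trans by blast
  then show ?thesis
    using infinite_iff_natLeq_ordLeq by blast
qed

lemma countable_less_kappa:
  assumes "countable A"
  shows "|A| <o (kappa :: 'k rel)"
proof -
  have "|A| \<le>o |UNIV :: nat set|"
    using assms card_of_ordLeq by (auto simp: countable_def)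
  then have "|A| \<le>o natLeq"
    using card_of_nat ordLeq_ordIso_trans by blast
  then show ?thesis
    using strong ordLeq_ordLess_trans by (auto simp: uncountable_regular_strong_def)
qed

lemma lessThan_less_kappa: "|{..<\<alpha>}| <o (kappa :: 'k rel)" for \<alpha> :: 'k
proof -
  have "underS (kappa :: 'k rel) \<alpha> = {..<\<alpha>}"
    by (auto simp: underS_def kappa_def)
  then show ?thesis
    using card_of_underS[OF kappa_Card_order, of \<alpha>] by simp
qed

lemma image_lessThan_less_kappa: "|f ` {..<\<alpha>}| <o (kappa :: 'k rel)" for \<alpha> :: 'k
  using card_of_image lessThan_less_kappa ordLeq_ordLess_trans by blast

text \<open>
  A set of ordinals below \<open>\<kappa>\<close> without a strict upper bound is cofinal, so by regularity it has
  cardinality \<open>\<kappa>\<close>.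
\<close>

lemma small_imp_bounded:
  fixes A :: "'k set"
  assumes "|A| <o (kappa :: 'k rel)"
  shows "\<exists>\<delta>. \<forall>\<alpha>\<in>A. \<alpha> < \<delta>"
proof -
  have no_max: "\<exists>\<beta>. \<alpha> < \<beta>" for \<alpha> :: 'k
    using infinite_Card_order_limit[OF kappa_Card_order, of \<alpha>] infinite_UNIV_kappa
    by simp (auto simp: kappa_def le_less)
  have "\<not> cofinal A (kappa :: 'k rel)"
    using strong assms not_ordLess_ordIso
    by (auto simp: uncountable_regular_strong_def regularCard_def)
  then obtain \<gamma> where "\<forall>\<alpha>\<in>A. \<alpha> \<le> \<gamma>"
    by (auto simp: cofinal_def kappa_def) (metis le_less linorder_not_le)
  moreover obtain \<delta> where "\<gamma> < \<delta>"
    using no_max by blast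
  ultimately show ?thesis
    by (meson order.strict_trans1)
qed

lemma bounded_on_lessThan: "\<exists>\<delta>. \<forall>\<beta><\<alpha>. f \<beta> < \<delta>" for \<alpha> :: 'k and f :: "'k \<Rightarrow> 'k"
  using small_imp_bounded[OF image_lessThan_less_kappa, of f \<alpha>] by auto

lemma above_two: "\<exists>\<gamma>. \<alpha> < \<gamma> \<and> \<beta> < \<gamma>" for \<alpha> \<beta> :: 'k
  using small_imp_bounded[OF countable_less_kappa, of "{\<alpha>, \<beta>}"] by auto

lemma above: "\<exists>\<gamma>. \<alpha> < \<gamma>" for \<alpha> :: 'k
  using above_two by blast

lemma le_kappa_iff_surj:
  assumes "A \<noteq> {}"
  shows "|A| \<le>o (kappa :: 'k rel) \<longleftrightarrow> (\<exists>g :: 'k \<Rightarrow> 'a. range g = A)"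
proof -
  have "|A| \<le>o (kappa :: 'k rel) \<longleftrightarrow> |A| \<le>o |UNIV :: 'k set|"
    using kappa_eq_card_UNIV ordLeq_ordIso_trans ordIso_symmetric by blast
  then show ?thesis
    using card_of_ordLeq2[OF assms, of "UNIV :: 'k set"] by simp
qed

lemma pairing: "\<exists>pr :: 'k \<times> 'k \<Rightarrow> 'k. bij pr"
proof -
  have "|(UNIV :: 'k set) \<times> (UNIV :: 'k set)| =o |UNIV :: 'k set|"
    using infinite_UNIV_kappa card_of_Times_same_infinite by blast
  then show ?thesis
    by (simp add: card_of_ordIso[symmetric])
qed

lemma weight_le_iff_enumerated_base:
  "weight_le X (kappa :: 'k rel) \<longleftrightarrow>
     (\<exists>B :: 'k \<Rightarrow> 'x set. (\<forall>i. openin X (B i)) \<and>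
        (\<forall>U x. openin X U \<and> x \<in> U \<longrightarrow> (\<exists>i. x \<in> B i \<and> B i \<subseteq> U)))" (is "?L \<longleftrightarrow> ?R")
proof
  assume ?L
  then obtain \<B> where \<B>: "|\<B>| \<le>o (kappa :: 'k rel)" "\<forall>V\<in>\<B>. openin X V"
    "\<forall>U x. openin X U \<and> x \<in> U \<longrightarrow> (\<exists>V\<in>\<B>. x \<in> V \<and> V \<subseteq> U)"
    by (auto simp: weight_le_def)
  show ?R
  proof (cases "\<B> = {}")
    case True
    with \<B>(3) show ?thesis
      by (intro exI[of _ "\<lambda>_. {}"]) auto
  next
    case False
    with \<B>(1) obtain g :: "'k \<Rightarrow> 'x set" where "range g = \<B>"
      using le_kappa_iff_surj[OF False] by auto
    with \<B>(2,3) show ?thesis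
      by (intro exI[of _ g]) auto
  qed
next
  assume ?R
  then obtain B :: "'k \<Rightarrow> 'x set" where B: "\<forall>i. openin X (B i)"
    "\<forall>U x. openin X U \<and> x \<in> U \<longrightarrow> (\<exists>i. x \<in> B i \<and> B i \<subseteq> U)"
    by blast
  moreover have "|range B| \<le>o (kappa :: 'k rel)"
    using le_kappa_iff_surj[of "range B"] by blast
  ultimately show ?L
    unfolding weight_le_def by (intro exI[of _ "range B"]) auto
qed

lemma openin_Inter_small:
  assumes "additive_space (kappa :: 'k rel) X" "|\<U>| <o (kappa :: 'k rel)" "\<And>U. U \<in> \<U> \<Longrightarrow> openin X U"
  shows "openin X (topspace X \<inter> \<Inter>\<U>)"
  using assms by (auto simp: additive_space_def)

text \<open>
  The operator \<open>game_arena\<close> intersects any family over the ordinals below \<open>\<alpha>\<close>, inside the space;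
  it serves below for families that do not come from a run of the game as well.
\<close>

lemma openin_Inter_below:
  fixes V :: "'k \<Rightarrow> 'x set"
  assumes "additive_space (kappa :: 'k rel) X" "\<And>\<beta>. \<beta> < \<alpha> \<Longrightarrow> openin X (V \<beta>)"
  shows "openin X (game_arena X V \<alpha>)"
  unfolding game_arena_def
  by (rule openin_Inter_small) (use assms image_lessThan_less_kappa in auto)

end

section \<open>The bounded topology\<close>

text \<open>
  The basic neighbourhoods of \<open>x\<close> in the bounded topology are the classes of \<open>x\<close> under these
  equivalence relations, which get finer as \<open>\<alpha>\<close> grows.
\<close>

definition agree :: "'k::wellorder \<Rightarrow> ('k \<Rightarrow> 'b) \<Rightarrow> ('k \<Rightarrow> 'b) \<Rightarrow> bool" where
  "agree \<alpha> x y \<longleftrightarrow> (\<forall>\<beta><\<alpha>. x \<beta> = y \<beta>)"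

lemma agree_refl [simp]: "agree \<alpha> x x"
  and agree_sym: "agree \<alpha> x y \<Longrightarrow> agree \<alpha> y x"
  and agree_trans: "agree \<alpha> x y \<Longrightarrow> agree \<alpha> y z \<Longrightarrow> agree \<alpha> x z"
  and agree_mono: "agree \<beta> x y \<Longrightarrow> \<alpha> \<le> \<beta> \<Longrightarrow> agree \<alpha> x y"
  by (auto simp: agree_def)

lemma openin_bounded_iff:
  "openin bounded_topology U \<longleftrightarrow> (\<forall>x\<in>U. \<exists>\<alpha>. \<forall>y. agree \<alpha> x y \<longrightarrow> y \<in> U)"
  for U :: "('k::wellorder \<Rightarrow> 'k) set"
proof
  assume "openin bounded_topology U"
  then have "generate_topology_on {{x. \<forall>\<beta><\<alpha>. x \<beta> = s \<beta>} | \<alpha> (s :: 'k \<Rightarrow> 'k). True} U"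
    by (simp add: bounded_topology_def openin_topology_generated_by_iff)
  then show "\<forall>x\<in>U. \<exists>\<alpha>. \<forall>y. agree \<alpha> x y \<longrightarrow> y \<in> U"
  proof induction
    case (Int a b)
    show ?case
    proof
      fix x assume "x \<in> a \<inter> b"
      then obtain \<alpha> \<beta> where "\<forall>y. agree \<alpha> x y \<longrightarrow> y \<in> a" "\<forall>y. agree \<beta> x y \<longrightarrow> y \<in> b"
        using Int.IH by blast
      then have "\<forall>y. agree (max \<alpha> \<beta>) x y \<longrightarrow> y \<in> a \<inter> b"
        using agree_mono by (metis IntI max.cobounded1 max.cobounded2)
      then show "\<exists>\<alpha>. \<forall>y. agree \<alpha> x y \<longrightarrow> y \<in> a \<inter> b" ..
    qed
  next
    case (Basis s)
    then obtain \<alpha> t where "s = {x. \<forall>\<beta><\<alpha>. x \<beta> = t \<beta>}"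
      by blast
    then show ?case
      by (auto simp: agree_def intro!: exI[of _ \<alpha>])
  qed (simp, blast)
next
  assume U: "\<forall>x\<in>U. \<exists>\<alpha>. \<forall>y. agree \<alpha> x y \<longrightarrow> y \<in> U"
  have basic: "openin bounded_topology {y. agree \<alpha> x y}" for \<alpha> and x :: "'k \<Rightarrow> 'k"
    unfolding bounded_topology_def
    by (rule topology_generated_by_Basis) (auto simp: agree_def eq_commute[of "x _"])
  show "openin bounded_topology U"
  proof (subst openin_subopen, intro ballI)
    fix x assume "x \<in> U"
    with U obtain \<alpha> where "\<forall>y. agree \<alpha> x y \<longrightarrow> y \<in> U"
      by blast
    then show "\<exists>T. openin bounded_topology T \<and> x \<in> T \<and> T \<subseteq> U"
      using basic[of \<alpha> x] by (intro exI[of _ "{y. agree \<alpha> x y}"]) auto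
  qed
qed

lemma topspace_bounded [simp]: "topspace (bounded_topology :: ('k::wellorder \<Rightarrow> 'k) topology) = UNIV"
  using openin_subset[of "bounded_topology :: ('k \<Rightarrow> 'k) topology" UNIV]
  by (auto simp: openin_bounded_iff)

lemma closedin_bounded_iff:
  "closedin bounded_topology C \<longleftrightarrow> (\<forall>x. (\<forall>\<alpha>. \<exists>y\<in>C. agree \<alpha> x y) \<longrightarrow> x \<in> C)"
  for C :: "('k::wellorder \<Rightarrow> 'k) set"
proof -
  have "closedin bounded_topology C \<longleftrightarrow> (\<forall>x. x \<notin> C \<longrightarrow> \<not> (\<forall>\<alpha>. \<exists>y\<in>C. agree \<alpha> x y))"
    by (simp add: closedin_def openin_bounded_iff) blast
  then show ?thesis
    by blast
qed

text \<open>
  An embedding into the bounded topology is an injection that pulls the relations \<open>agree \<alpha>\<close> back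
  to a neighbourhood base at each point: the second conjunct says that the classes pulled back are
  neighbourhoods, the third that they are small. In this form embeddings can be built and
  used pointwise, without reference to the topology of the image.
\<close>

lemma embedding_map_bounded_iff:
  fixes f :: "'x \<Rightarrow> 'k::wellorder \<Rightarrow> 'k"
  shows "embedding_map X bounded_topology f \<longleftrightarrow>
    inj_on f (topspace X) \<and>
    (\<forall>x\<in>topspace X. \<forall>\<alpha>. \<exists>U. openin X U \<and> x \<in> U \<and> (\<forall>y\<in>U. agree \<alpha> (f x) (f y))) \<and>
    (\<forall>U x. openin X U \<and> x \<in> U \<longrightarrow> (\<exists>\<alpha>. \<forall>y\<in>topspace X. agree \<alpha> (f x) (f y) \<longrightarrow> y \<in> U))"
    (is "_ \<longleftrightarrow> ?inj \<and> ?cont \<and> ?open")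
proof -
  let ?Y = "subtopology bounded_topology (f ` topspace X)"
  have cont: "continuous_map X ?Y f \<longleftrightarrow> ?cont"
  proof
    assume "continuous_map X ?Y f"
    then have c: "continuous_map X bounded_topology f"
      using continuous_map_in_subtopology by blast
    show ?cont
    proof (intro ballI allI)
      fix x \<alpha> assume x: "x \<in> topspace X"
      have "openin bounded_topology {z. agree \<alpha> (f x) z}"
        by (auto simp: openin_bounded_iff intro: agree_trans)
      from openin_continuous_map_preimage[OF c this]
      show "\<exists>U. openin X U \<and> x \<in> U \<and> (\<forall>y\<in>U. agree \<alpha> (f x) (f y))"
        using x by (intro exI[of _ "{y \<in> topspace X. f y \<in> {z. agree \<alpha> (f x) z}}"]) simp
    qed
  next
    assume C: ?cont
    have "continuous_map X bounded_topology f"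
      unfolding continuous_map_def
    proof (intro conjI allI impI)
      fix U :: "('k \<Rightarrow> 'k) set" assume U: "openin bounded_topology U"
      show "openin X {x \<in> topspace X. f x \<in> U}"
      proof (subst openin_subopen, intro ballI)
        fix x assume x: "x \<in> {x \<in> topspace X. f x \<in> U}"
        then obtain \<alpha> where \<alpha>: "\<forall>y. agree \<alpha> (f x) y \<longrightarrow> y \<in> U"
          using U by (auto simp: openin_bounded_iff)
        obtain T where "openin X T" "x \<in> T" "\<forall>y\<in>T. agree \<alpha> (f x) (f y)"
          using C x by blast
        with \<alpha> show "\<exists>T. openin X T \<and> x \<in> T \<and> T \<subseteq> {x \<in> topspace X. f x \<in> U}"
          using openin_subset by (intro exI[of _ T]) blast
      qed
    qed auto
    then show "continuous_map X ?Y f"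
      by (simp add: continuous_map_in_subtopology)
  qed
  have opn: "open_map X ?Y f \<longleftrightarrow> ?open" if inj: ?inj
  proof
    assume O: "open_map X ?Y f"
    show ?open
    proof (intro allI impI, elim conjE)
      fix U x assume U: "openin X U" "x \<in> U"
      with O have "openin ?Y (f ` U)"
        by (auto simp: open_map_def)
      then obtain T where T: "openin bounded_topology T" "f ` U = T \<inter> f ` topspace X"
        by (auto simp: openin_subtopology)
      with U obtain \<alpha> where \<alpha>: "\<forall>y. agree \<alpha> (f x) y \<longrightarrow> y \<in> T"
        by (metis IntE image_eqI openin_bounded_iff)
      have "y \<in> U" if y: "y \<in> topspace X" "agree \<alpha> (f x) (f y)" for y
      proof -
        have "f y \<in> f ` U"
          using y \<alpha> T by auto
        then show ?thesis
          using inj y openin_subset[OF U(1)] by (auto dest: inj_onD)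
      qed
      then show "\<exists>\<alpha>. \<forall>y\<in>topspace X. agree \<alpha> (f x) (f y) \<longrightarrow> y \<in> U"
        by blast
    qed
  next
    assume O: ?open
    show "open_map X ?Y f"
      unfolding open_map_def
    proof (intro allI impI)
      fix U assume U: "openin X U"
      define T where "T = {z. \<exists>x\<in>U. \<exists>\<alpha>. agree \<alpha> (f x) z \<and>
        (\<forall>y\<in>topspace X. agree \<alpha> (f x) (f y) \<longrightarrow> y \<in> U)}"
      have "openin bounded_topology T"
        unfolding openin_bounded_iff T_def by (blast intro: agree_trans)
      moreover have "f ` U = T \<inter> f ` topspace X"
      proof
        show "f ` U \<subseteq> T \<inter> f ` topspace X"
        proof (intro image_subsetI IntI)
          fix x assume x: "x \<in> U"
          then obtain \<alpha> where "\<forall>y\<in>topspace X. agree \<alpha> (f x) (f y) \<longrightarrow> y \<in> U"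
            using O U by blast
          with x show "f x \<in> T"
            unfolding T_def by (auto intro: agree_refl)
          show "f x \<in> f ` topspace X"
            using x openin_subset[OF U] by blast
        qed
        show "T \<inter> f ` topspace X \<subseteq> f ` U"
          unfolding T_def by blast
      qed
      ultimately show "openin ?Y (f ` U)"
        by (auto simp: openin_subtopology)
    qed
  qed
  have "embedding_map X bounded_topology f \<longleftrightarrow> ?inj \<and> continuous_map X ?Y f \<and> open_map X ?Y f"
    unfolding embedding_map_def
    using bijective_open_imp_homeomorphic_map[of X ?Y f] homeomorphic_eq_everything_map[of X ?Y f]
    by auto
  also have "\<dots> \<longleftrightarrow> ?inj \<and> ?cont \<and> ?open"
    by (intro conj_cong refl cont opn)
  finally show ?thesis .
qed

lemma homeomorphic_subspace_bounded_iff: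
  fixes S :: "('k::wellorder \<Rightarrow> 'k) set"
  shows "X homeomorphic_space subtopology bounded_topology S \<longleftrightarrow>
    (\<exists>f. embedding_map X bounded_topology f \<and> f ` topspace X = S)"
proof
  assume "X homeomorphic_space subtopology bounded_topology S"
  then obtain f where f: "homeomorphic_map X (subtopology bounded_topology S) f"
    by (auto simp: homeomorphic_space)
  then have "f ` topspace X = S"
    by (simp add: homeomorphic_eq_everything_map)
  with f show "\<exists>f. embedding_map X bounded_topology f \<and> f ` topspace X = S"
    by (auto simp: embedding_map_def)
next
  assume "\<exists>f. embedding_map X bounded_topology f \<and> f ` topspace X = S"
  then show "X homeomorphic_space subtopology bounded_topology S"
    by (auto simp: embedding_map_def homeomorphic_space)
qed

section \<open>Subspaces of the bounded topology\<close>

lemma embedding_map_boundedD: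
  fixes f :: "'x \<Rightarrow> 'k::wellorder \<Rightarrow> 'k"
  assumes "embedding_map X bounded_topology f"
  shows embedding_inj: "inj_on f (topspace X)"
    and embedding_cont: "x \<in> topspace X \<Longrightarrow> \<exists>U. openin X U \<and> x \<in> U \<and> (\<forall>y\<in>U. agree \<alpha> (f x) (f y))"
    and embedding_nbhd: "openin X U \<Longrightarrow> x \<in> U \<Longrightarrow>
      \<exists>\<alpha>. \<forall>y\<in>topspace X. agree \<alpha> (f x) (f y) \<longrightarrow> y \<in> U"
  using assms unfolding embedding_map_bounded_iff by blast+

text \<open>
  The closed set \<open>C\<close> is the intersection of its \<open>\<kappa>\<close>-many neighbourhoods of radius \<open>\<alpha>\<close>.
\<close>

lemma closedin_bounded_imp_Gdelta:
  fixes C :: "('k::wellorder \<Rightarrow> 'k) set"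
  assumes "closedin bounded_topology C"
  shows "Gdelta_kappa TYPE('k) bounded_topology C"
proof -
  have "openin bounded_topology {x. \<exists>c\<in>C. agree \<alpha> x c}" for \<alpha>
    unfolding openin_bounded_iff by (blast intro: agree_trans agree_sym)
  moreover have "C = (\<Inter>\<alpha>. {x. \<exists>c\<in>C. agree \<alpha> x c})"
  proof
    show "C \<subseteq> (\<Inter>\<alpha>. {x. \<exists>c\<in>C. agree \<alpha> x c})"
      by (auto intro: agree_refl)
    show "(\<Inter>\<alpha>. {x. \<exists>c\<in>C. agree \<alpha> x c}) \<subseteq> C"
      using assms unfolding closedin_bounded_iff by auto
  qed
  ultimately show ?thesis
    unfolding Gdelta_kappa_def by (intro exI[of _ "\<lambda>\<alpha>. {x. \<exists>c\<in>C. agree \<alpha> x c}"] conjI allI)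
qed

context strong_cardinal
begin

text \<open>
  For a set \<open>S = (\<Inter>\<alpha>. G \<alpha>)\<close> with open \<open>G \<alpha>\<close>, let \<open>m w \<alpha>\<close> be the least length at which an initial segment
  of \<open>w \<in> S\<close> certifies membership in \<open>G \<alpha>\<close>. The map \<open>m\<close> is continuous on \<open>S\<close>, so \<open>S\<close> is homeomorphic to
  its graph, and the graph is closed: a limit of pairs \<open>(w, m w)\<close> keeps all the certificates and
  thus belongs to the graph over \<open>S\<close>. A pairing function \<open>pr\<close> on \<open>\<kappa>\<close> turns the graph into a set of
  functions from \<open>\<kappa>\<close> to \<open>\<kappa>\<close>.
\<close>

lemma Gdelta_embedding_imp_closed_embedding:
  fixes f :: "'x \<Rightarrow> 'k \<Rightarrow> 'k"
  assumes f: "embedding_map X bounded_topology f"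
    and Gdelta: "Gdelta_kappa TYPE('k) bounded_topology (f ` topspace X)"
  shows "\<exists>g :: 'x \<Rightarrow> 'k \<Rightarrow> 'k. embedding_map X bounded_topology g \<and>
    closedin bounded_topology (g ` topspace X)"
proof -
  let ?S = "f ` topspace X"
  obtain G where G: "\<And>\<alpha> :: 'k. openin bounded_topology (G \<alpha>)" and S: "?S = (\<Inter>\<alpha>. G \<alpha>)"
    using Gdelta by (auto simp: Gdelta_kappa_def)
  obtain pr :: "'k \<times> 'k \<Rightarrow> 'k" where pr: "bij pr"
    using pairing by blast
  then have pr_inj: "pr p = pr q \<longleftrightarrow> p = q" for p q
    by (simp add: bij_is_inj inj_eq)
  define N where "N \<gamma> w = {y :: 'k \<Rightarrow> 'k. agree \<gamma> w y}" for \<gamma> w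
  define m where "m w \<alpha> = (LEAST \<gamma>. N \<gamma> w \<subseteq> G \<alpha>)" for w \<alpha>
  define h where "h w \<alpha> = pr (w \<alpha>, m w \<alpha>)" for w \<alpha>
  have N_eq: "N \<gamma> w = N \<gamma> w'" if "agree \<delta> w w'" "\<gamma> \<le> \<delta>" for \<gamma> \<delta> w w'
    using that unfolding N_def by (blast intro: agree_trans agree_sym agree_mono)
  have N_m: "N (m w \<alpha>) w \<subseteq> G \<alpha>" if "w \<in> ?S" for w \<alpha>
  proof -
    have "w \<in> G \<alpha>"
      using that S by blast
    then obtain \<gamma> where "\<forall>y. agree \<gamma> w y \<longrightarrow> y \<in> G \<alpha>"
      using G[of \<alpha>] openin_bounded_iff[of "G \<alpha>"] by blast
    then have "N \<gamma> w \<subseteq> G \<alpha>"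
      by (auto simp: N_def)
    then show ?thesis
      unfolding m_def by (rule LeastI)
  qed
  \<comment> \<open>The certificate depends only on the initial segment that it names.\<close>
  have m_local: "m w' \<alpha> = m w \<alpha>" if w: "w \<in> ?S" and agr: "agree \<delta> w w'" and le: "m w \<alpha> \<le> \<delta>"
    for w w' \<alpha> \<delta>
  proof (rule antisym)
    have N': "N (m w \<alpha>) w' \<subseteq> G \<alpha>"
      using N_m[OF w, of \<alpha>] N_eq[OF agr le] by simp
    then show le': "m w' \<alpha> \<le> m w \<alpha>"
      unfolding m_def[of w'] by (rule Least_le)
    have "N (m w' \<alpha>) w' \<subseteq> G \<alpha>"
      using N' unfolding m_def[of w'] by (rule LeastI)
    then have "N (m w' \<alpha>) w \<subseteq> G \<alpha>"
      using N_eq[OF agr order_trans[OF le' le]] by simp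
    then show "m w \<alpha> \<le> m w' \<alpha>"
      unfolding m_def[of w] by (rule Least_le)
  qed
  have h_agree: "agree \<alpha> (h w) (h w') \<Longrightarrow> agree \<alpha> w w'" for \<alpha> w w'
    by (simp add: agree_def h_def pr_inj)
  define g where "g x = h (f x)" for x
  have "embedding_map X bounded_topology g"
    unfolding embedding_map_bounded_iff
  proof (intro conjI ballI allI impI; (elim conjE)?)
    have "inj h"
      by (rule injI) (auto simp: h_def pr_inj fun_eq_iff)
    then show "inj_on g (topspace X)"
      using embedding_inj[OF f] by (auto simp: g_def inj_on_def)
  next
    fix x \<alpha> assume x: "x \<in> topspace X"
    obtain \<delta>\<^sub>0 where \<delta>\<^sub>0: "\<forall>\<beta><\<alpha>. m (f x) \<beta> < \<delta>\<^sub>0"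
      using bounded_on_lessThan by blast
    define \<delta> where "\<delta> = max \<alpha> \<delta>\<^sub>0"
    obtain U where U: "openin X U" "x \<in> U" "\<forall>y\<in>U. agree \<delta> (f x) (f y)"
      using embedding_cont[OF f x] by blast
    have "agree \<alpha> (g x) (g y)" if "y \<in> U" for y
    proof -
      have agr: "agree \<delta> (f x) (f y)"
        using U that by blast
      have "m (f y) \<beta> = m (f x) \<beta>" if "\<beta> < \<alpha>" for \<beta>
        using m_local[OF _ agr] \<delta>\<^sub>0 that x by (auto simp: \<delta>_def le_max_iff_disj less_imp_le)
      moreover have "f y \<beta> = f x \<beta>" if "\<beta> < \<alpha>" for \<beta>
        using agr that by (simp add: agree_def \<delta>_def less_max_iff_disj)
      ultimately show ?thesis
        by (simp add: agree_def g_def h_def)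
    qed
    with U(1,2) show "\<exists>U. openin X U \<and> x \<in> U \<and> (\<forall>y\<in>U. agree \<alpha> (g x) (g y))"
      by blast
  next
    fix U x assume "openin X U" "x \<in> U"
    from embedding_nbhd[OF f this] obtain \<alpha>
      where "\<forall>y\<in>topspace X. agree \<alpha> (f x) (f y) \<longrightarrow> y \<in> U"
      by blast
    then show "\<exists>\<alpha>. \<forall>y\<in>topspace X. agree \<alpha> (g x) (g y) \<longrightarrow> y \<in> U"
      using h_agree unfolding g_def by blast
  qed
  moreover have "closedin bounded_topology (g ` topspace X)"
    unfolding closedin_bounded_iff
  proof (intro allI impI)
    fix z assume z: "\<forall>\<alpha>. \<exists>y\<in>g ` topspace X. agree \<alpha> z y"
    define w where "w \<alpha> = fst (inv pr (z \<alpha>))" for \<alpha>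
    define l where "l \<alpha> = snd (inv pr (z \<alpha>))" for \<alpha>
    have z_eq: "z \<alpha> = pr (w \<alpha>, l \<alpha>)" for \<alpha>
      using pr by (simp add: w_def l_def bij_is_surj surj_f_inv_f)
    have w: "w \<in> G \<alpha> \<and> m w \<alpha> = l \<alpha>" for \<alpha>
    proof -
      obtain \<gamma> where \<gamma>: "\<alpha> < \<gamma>" "l \<alpha> < \<gamma>"
        using above_two by blast
      obtain v where v: "v \<in> ?S" "agree \<gamma> z (h v)"
        using z unfolding g_def by blast
      have "agree \<gamma> v w" "m v \<alpha> = l \<alpha>"
        using v(2) \<gamma>(1) by (auto simp: agree_def z_eq h_def pr_inj)
      moreover from this have "N (l \<alpha>) w \<subseteq> G \<alpha>"
        using N_m[OF v(1), of \<alpha>] N_eq[of \<gamma> v w "l \<alpha>"] \<gamma>(2) by simp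
      ultimately show ?thesis
        using m_local[OF v(1), of \<gamma> w \<alpha>] \<gamma>(2) by (auto simp: N_def)
    qed
    then have "w \<in> ?S"
      using S by blast
    moreover have "z = h w"
      using w by (auto simp: h_def z_eq)
    ultimately show "z \<in> g ` topspace X"
      by (auto simp: g_def)
  qed
  ultimately show ?thesis
    by blast
qed

text \<open>
  There are only \<open>\<kappa>\<close>-many basic open sets, because \<open>2\<close> to the power \<open><\<kappa>\<close> is \<open>\<kappa>\<close>: the restriction of
  \<open>f x\<close> to \<open>\<alpha>\<close> is, as a graph, a subset of \<open>\<alpha> \<times> \<kappa>\<close>, a pairing function \<open>pr\<close> turns this subset into a subset of \<open>\<kappa>\<close>, and by
  regularity the latter is bounded by some \<open>\<delta>\<close>, so that its characteristic function is a binary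
  sequence of length \<open>\<delta>\<close>.
\<close>

lemma embedding_imp_weight_le:
  fixes f :: "'x \<Rightarrow> 'k \<Rightarrow> 'k"
  assumes f: "embedding_map X bounded_topology f"
  shows "weight_le X (kappa :: 'k rel)"
proof -
  obtain pr :: "'k \<times> 'k \<Rightarrow> 'k" where "bij pr"
    using pairing by blast
  then have pr_inj: "pr p = pr q \<longleftrightarrow> p = q" for p q
    by (simp add: bij_is_inj inj_eq)
  \<comment> \<open>Most codes \<open>(\<alpha>, \<delta>, \<phi>)\<close> do not come from a point, but the open set \<open>D (\<alpha>, \<delta>, \<phi>)\<close> makes sense for all.\<close>
  define D where "D = (\<lambda>(\<alpha>, \<delta>, \<phi>). {x \<in> topspace X. \<forall>\<beta><\<alpha>. pr (\<beta>, f x \<beta>) < \<delta> \<and> \<phi> (pr (\<beta>, f x \<beta>))})"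
  let ?I = "(UNIV :: 'k set) \<times> (binary_seqs_below :: ('k \<times> ('k \<Rightarrow> bool)) set)"
  have "|binary_seqs_below :: ('k \<times> ('k \<Rightarrow> bool)) set| \<le>o (kappa :: 'k rel)"
    using strong ordIso_iff_ordLeq by (auto simp: uncountable_regular_strong_def)
  moreover have "|UNIV :: 'k set| \<le>o (kappa :: 'k rel)"
    using kappa_eq_card_UNIV ordIso_iff_ordLeq by blast
  ultimately have "|?I| \<le>o (kappa :: 'k rel)"
    using infinite_UNIV_kappa kappa_Card_order by (intro card_of_Times_ordLeq_infinite_Field) auto
  then have "|D ` ?I| \<le>o (kappa :: 'k rel)"
    using card_of_image ordLeq_transitive by blast
  moreover have "openin X (D i)" for i
  proof (cases i)
    case (fields \<alpha> \<delta> \<phi>)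
    show ?thesis
    proof (subst openin_subopen, intro ballI)
      fix x assume x: "x \<in> D i"
      then have "x \<in> topspace X"
        by (auto simp: D_def fields)
      then obtain U where U: "openin X U" "x \<in> U" "\<forall>y\<in>U. agree \<alpha> (f x) (f y)"
        using embedding_cont[OF f] by blast
      have "U \<subseteq> D i"
        using x U(3) openin_subset[OF U(1)] by (auto simp: D_def fields agree_def)
      with U(1,2) show "\<exists>T. openin X T \<and> x \<in> T \<and> T \<subseteq> D i"
        by blast
    qed
  qed
  moreover have "\<exists>i\<in>?I. x \<in> D i \<and> D i \<subseteq> U" if U: "openin X U" "x \<in> U" for U x
  proof -
    obtain \<alpha> where \<alpha>: "\<forall>y\<in>topspace X. agree \<alpha> (f x) (f y) \<longrightarrow> y \<in> U"
      using embedding_nbhd[OF f U] by blast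
    obtain \<delta> where \<delta>: "\<forall>\<beta><\<alpha>. pr (\<beta>, f x \<beta>) < \<delta>"
      using bounded_on_lessThan[of \<alpha> "\<lambda>\<beta>. pr (\<beta>, f x \<beta>)"] by blast
    define \<phi> where "\<phi> = restrict (\<lambda>\<gamma>. \<exists>\<beta><\<alpha>. \<gamma> = pr (\<beta>, f x \<beta>)) {..<\<delta>}"
    have "(\<alpha>, \<delta>, \<phi>) \<in> ?I"
      by (simp add: binary_seqs_below_def \<phi>_def)
    moreover have "x \<in> D (\<alpha>, \<delta>, \<phi>)"
      using \<delta> U openin_subset by (auto simp: D_def \<phi>_def)
    moreover have "D (\<alpha>, \<delta>, \<phi>) \<subseteq> U"
      using \<alpha> unfolding D_def \<phi>_def agree_def by (auto simp: pr_inj) metis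
    ultimately show ?thesis
      by blast
  qed
  ultimately show ?thesis
    unfolding weight_le_def by (intro exI[of _ "D ` ?I"]) auto
qed

end

section \<open>Metrics with values in an ordered group of degree \<open>\<kappa>\<close>\<close>

lemma openin_group_ball:
  assumes "group_metric_on M d" "x \<in> M"
  shows "openin (group_metric_topology M d) {y\<in>M. d x y < \<epsilon>}"
proof (cases "0 < \<epsilon>")
  case True
  with assms(2) show ?thesis
    unfolding group_metric_topology_def by (intro topology_generated_by_Basis) blast
next
  case False
  moreover have "0 \<le> d x y" if "y \<in> M" for y
    using assms that by (simp add: group_metric_on_def)
  ultimately have empty: "{y\<in>M. d x y < \<epsilon>} = {}"
    by force
  show ?thesis
    unfolding empty by simp
qed

lemma openin_group_metric_iff:
  fixes d :: "'x \<Rightarrow> 'x \<Rightarrow> 'g::linordered_ab_group_add"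
  assumes d: "group_metric_on M d"
  shows "openin (group_metric_topology M d) U \<longleftrightarrow>
    U \<subseteq> M \<and> (\<forall>x\<in>U. \<exists>\<epsilon>>0. \<forall>y\<in>M. d x y < \<epsilon> \<longrightarrow> y \<in> U)"
proof
  assume "openin (group_metric_topology M d) U"
  then have "generate_topology_on {{y\<in>M. d x y < \<epsilon>} | x \<epsilon>. x \<in> M \<and> 0 < \<epsilon>} U"
    by (simp add: group_metric_topology_def openin_topology_generated_by_iff)
  then show "U \<subseteq> M \<and> (\<forall>x\<in>U. \<exists>\<epsilon>>0. \<forall>y\<in>M. d x y < \<epsilon> \<longrightarrow> y \<in> U)"
  proof induction
    case Empty
    then show ?case by simp
  next
    case (Int a b)
    have "\<exists>\<epsilon>>0. \<forall>y\<in>M. d x y < \<epsilon> \<longrightarrow> y \<in> a \<inter> b" if x: "x \<in> a \<inter> b" for x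
    proof -
      obtain \<epsilon> \<delta> where "\<epsilon> > 0" "\<forall>y\<in>M. d x y < \<epsilon> \<longrightarrow> y \<in> a" "\<delta> > 0" "\<forall>y\<in>M. d x y < \<delta> \<longrightarrow> y \<in> b"
        using Int.IH x by blast
      then show ?thesis
        by (intro exI[of _ "min \<epsilon> \<delta>"]) simp
    qed
    with Int.IH show ?case
      by blast
  next
    case (UN K)
    have "\<exists>\<epsilon>>0. \<forall>y\<in>M. d x y < \<epsilon> \<longrightarrow> y \<in> \<Union>K" if x: "x \<in> \<Union>K" for x
    proof -
      obtain V where "V \<in> K" "x \<in> V"
        using x by blast
      with UN.IH[of V] show ?thesis
        by blast
    qed
    with UN.IH show ?case
      by blast
  next
    case (Basis s)
    then obtain z \<epsilon> where s: "s = {y\<in>M. d z y < \<epsilon>}" and z: "z \<in> M"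
      by blast
    have "\<exists>\<delta>>0. \<forall>y\<in>M. d x y < \<delta> \<longrightarrow> y \<in> s" if x: "x \<in> s" for x
    proof (intro exI[of _ "\<epsilon> - d z x"] conjI ballI impI)
      show "0 < \<epsilon> - d z x"
        using x s by simp
      fix y assume y: "y \<in> M" "d x y < \<epsilon> - d z x"
      have "x \<in> M"
        using x s by blast
      then have "d z y \<le> d z x + d x y"
        using d y(1) z unfolding group_metric_on_def by blast
      also have "\<dots> < \<epsilon>"
        using y(2) by (simp add: less_diff_eq add.commute)
      finally show "y \<in> s"
        using y s by simp
    qed
    then show ?case
      using s by blast
  qed
next
  assume U: "U \<subseteq> M \<and> (\<forall>x\<in>U. \<exists>\<epsilon>>0. \<forall>y\<in>M. d x y < \<epsilon> \<longrightarrow> y \<in> U)"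
  show "openin (group_metric_topology M d) U"
  proof (subst openin_subopen, intro ballI)
    fix x assume x: "x \<in> U"
    with U obtain \<epsilon> where \<epsilon>: "\<epsilon> > 0" "\<forall>y\<in>M. d x y < \<epsilon> \<longrightarrow> y \<in> U"
      by blast
    have xM: "x \<in> M"
      using U x by blast
    then have "openin (group_metric_topology M d) {y\<in>M. d x y < \<epsilon>}"
      using openin_group_ball[OF d] by blast
    moreover have "d x x = 0"
      using d xM by (simp add: group_metric_on_def)
    ultimately show "\<exists>T. openin (group_metric_topology M d) T \<and> x \<in> T \<and> T \<subseteq> U"
      using \<epsilon> xM by (intro exI[of _ "{y\<in>M. d x y < \<epsilon>}"]) auto
  qed
qed

locale deg_group = strong_cardinal k for k :: "'k::wellorder itself" +
  fixes g :: "'g::linordered_ab_group_add itself"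
  assumes deg: "has_Deg g (kappa :: 'k rel)"
begin

text \<open>
  A set of positive elements without a positive strict lower bound is coinitial, hence has at
  least \<open>\<kappa>\<close> elements. All uses of the degree of the group rest on this and on the existence of a
  coinitial family indexed by \<open>\<kappa>\<close>.
\<close>

lemma small_lower_bound:
  fixes E :: "'g set"
  assumes "|E| <o (kappa :: 'k rel)" "\<And>e. e \<in> E \<Longrightarrow> 0 < e"
  shows "\<exists>a>0. \<forall>e\<in>E. a < e"
proof -
  have "\<not> coinitial_in E {\<epsilon>. 0 < \<epsilon>}"
    using deg assms(1) not_ordLeq_ordLess by (auto simp: has_Deg_def has_coinitiality_def)
  with assms(2) show ?thesis
    by (auto simp: coinitial_in_def not_le)
qed

lemma coinitial_enumeration: "\<exists>e :: 'k \<Rightarrow> 'g. (\<forall>\<alpha>. 0 < e \<alpha>) \<and> (\<forall>\<epsilon>>0. \<exists>\<alpha>. e \<alpha> \<le> \<epsilon>)"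
proof -
  obtain B :: "'g set" where B: "coinitial_in B {\<epsilon>. 0 < \<epsilon>}" "|B| =o (kappa :: 'k rel)"
    using deg by (auto simp: has_Deg_def has_coinitiality_def)
  obtain a :: 'g where "0 < a"
    using small_lower_bound[OF countable_less_kappa, of "{}"] by auto
  with B(1) have "B \<noteq> {}"
    by (auto simp: coinitial_in_def)
  moreover have "|B| \<le>o (kappa :: 'k rel)"
    using B(2) ordIso_iff_ordLeq by blast
  ultimately obtain e :: "'k \<Rightarrow> 'g" where e: "range e = B"
    using le_kappa_iff_surj[of B] by blast
  have "0 < e \<alpha>" for \<alpha>
    using B(1) e by (auto simp: coinitial_in_def)
  moreover have "\<exists>\<alpha>. e \<alpha> \<le> \<epsilon>" if "0 < \<epsilon>" for \<epsilon>
    using B(1) e that by (auto simp: coinitial_in_def)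
  ultimately show ?thesis
    by blast
qed

lemma coinitial_strictly_decreasing:
  "\<exists>e :: 'k \<Rightarrow> 'g. (\<forall>\<alpha>. 0 < e \<alpha>) \<and> (\<forall>\<alpha> \<beta>. \<alpha> < \<beta> \<longrightarrow> e \<beta> < e \<alpha>) \<and> (\<forall>\<epsilon>>0. \<exists>\<alpha>. e \<alpha> \<le> \<epsilon>)"
proof -
  obtain c :: "'k \<Rightarrow> 'g" where c: "\<And>\<alpha>. 0 < c \<alpha>" "\<And>\<epsilon>. \<epsilon> > 0 \<Longrightarrow> \<exists>\<alpha>. c \<alpha> \<le> \<epsilon>"
    using coinitial_enumeration by blast
  have "\<exists>e :: 'k \<Rightarrow> 'g. \<forall>\<alpha>. 0 < e \<alpha> \<and> e \<alpha> \<le> c \<alpha> \<and> (\<forall>\<beta><\<alpha>. e \<alpha> < e \<beta>)"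
  proof (rule dependent_wellorder_choice)
    fix e :: "'k \<Rightarrow> 'g" and \<alpha> assume "\<And>\<beta>. \<beta> < \<alpha> \<Longrightarrow> 0 < e \<beta> \<and> e \<beta> \<le> c \<beta> \<and> (\<forall>\<gamma><\<beta>. e \<beta> < e \<gamma>)"
    then obtain a where a: "a > 0" "\<forall>b\<in>e ` {..<\<alpha>}. a < b"
      using small_lower_bound[OF image_lessThan_less_kappa, of e \<alpha>] by auto
    then show "\<exists>r. 0 < r \<and> r \<le> c \<alpha> \<and> (\<forall>\<beta><\<alpha>. r < e \<beta>)"
      using c(1)[of \<alpha>] by (intro exI[of _ "min a (c \<alpha>)"]) (auto simp: min_less_iff_disj)
  qed auto
  then obtain e :: "'k \<Rightarrow> 'g" where e: "\<And>\<alpha>. 0 < e \<alpha>" "\<And>\<alpha>. e \<alpha> \<le> c \<alpha>" "\<And>\<alpha> \<beta>. \<beta> < \<alpha> \<Longrightarrow> e \<alpha> < e \<beta>"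
    by blast
  moreover have "\<exists>\<alpha>. e \<alpha> \<le> \<epsilon>" if "\<epsilon> > 0" for \<epsilon>
    using c(2)[OF that] e(2) order_trans by blast
  ultimately show ?thesis
    by blast
qed

text \<open>
  There is no least positive element, as it would form a coinitial set by itself. With
  \<open>0 < a < \<epsilon>\<close>, the smaller of \<open>a\<close> and \<open>\<epsilon> - a\<close> can serve as \<open>\<delta>\<close>.
\<close>

lemma halving:
  assumes "(0::'g) < \<epsilon>"
  shows "\<exists>\<delta>>0. \<delta> + \<delta> \<le> \<epsilon>"
proof -
  obtain a where a: "0 < a" "a < \<epsilon>"
    using small_lower_bound[OF countable_less_kappa, of "{\<epsilon>}"] assms by auto
  define \<delta> where "\<delta> = min a (\<epsilon> - a)"
  have "\<delta> + \<delta> \<le> a + (\<epsilon> - a)"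
    unfolding \<delta>_def by (intro add_mono) auto
  moreover have "0 < \<delta>"
    using a by (simp add: \<delta>_def)
  ultimately show ?thesis
    by auto
qed

text \<open>
  Let \<open>e\<close> be a strictly decreasing coinitial family of positive elements. The distance of two points is
  \<open>e \<alpha>\<close> for the first place \<open>\<alpha>\<close> at which their images differ. This is an ultrametric, and all of its
  properties come from one observation: the distance is less than \<open>e \<alpha>\<close> iff the images agree up to
  and including \<open>\<alpha>\<close>. A Cauchy sequence thus stabilizes at every coordinate, and its coordinatewise
  limit is in the image because the image is closed.
\<close>

lemma closed_embedding_imp_group_Polish:
  fixes f :: "'x \<Rightarrow> 'k \<Rightarrow> 'k"
  assumes f: "embedding_map X bounded_topology f"
    and closed: "closedin bounded_topology (f ` topspace X)"
  shows "group_Polish k g X"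
proof -
  let ?M = "topspace X"
  obtain e :: "'k \<Rightarrow> 'g" where pos: "\<And>\<alpha>. 0 < e \<alpha>"
    and decr: "\<And>\<alpha> \<beta>. \<alpha> < \<beta> \<Longrightarrow> e \<beta> < e \<alpha>" and coin: "\<And>\<epsilon>. \<epsilon> > 0 \<Longrightarrow> \<exists>\<alpha>. e \<alpha> \<le> \<epsilon>"
    using coinitial_strictly_decreasing by blast
  have e_less: "e \<beta> < e \<alpha> \<longleftrightarrow> \<alpha> < \<beta>" for \<alpha> \<beta>
    using decr by (metis less_asym linorder_neqE order_less_irrefl)
  define d where "d x y = (if f x = f y then 0 else e (LEAST \<alpha>. f x \<alpha> \<noteq> f y \<alpha>))" for x y
  have d_less: "d x y < e \<alpha> \<longleftrightarrow> (\<forall>\<beta>\<le>\<alpha>. f x \<beta> = f y \<beta>)" for x y \<alpha>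
  proof (cases "f x = f y")
    case True
    then show ?thesis
      by (simp add: d_def pos)
  next
    case False
    then have "\<exists>\<beta>. f x \<beta> \<noteq> f y \<beta>"
      by blast
    then have L: "f x (LEAST \<alpha>. f x \<alpha> \<noteq> f y \<alpha>) \<noteq> f y (LEAST \<alpha>. f x \<alpha> \<noteq> f y \<alpha>)"
      by (rule LeastI_ex)
    have "\<alpha> < (LEAST \<alpha>. f x \<alpha> \<noteq> f y \<alpha>) \<longleftrightarrow> (\<forall>\<beta>\<le>\<alpha>. f x \<beta> = f y \<beta>)"
      using L not_less_Least[of _ "\<lambda>\<alpha>. f x \<alpha> \<noteq> f y \<alpha>"] by (meson le_less_trans not_less)
    then show ?thesis
      using False by (simp add: d_def e_less)
  qed
  have nonneg: "0 \<le> d x y" for x y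
    using pos by (auto simp: d_def less_imp_le)
  have "d x z \<le> d x y + d y z" for x y z
  proof (cases "f x = f z")
    case True
    then show ?thesis
      using nonneg by (simp add: d_def[of x z])
  next
    case False
    then have "\<exists>\<beta>. f x \<beta> \<noteq> f z \<beta>"
      by blast
    define \<gamma> where "\<gamma> = (LEAST \<alpha>. f x \<alpha> \<noteq> f z \<alpha>)"
    have "f x \<gamma> \<noteq> f z \<gamma>"
      unfolding \<gamma>_def using \<open>\<exists>\<beta>. f x \<beta> \<noteq> f z \<beta>\<close> by (rule LeastI_ex)
    then have "\<not> d x y < e \<gamma> \<or> \<not> d y z < e \<gamma>"
      using d_less by auto
    moreover have "d x z = e \<gamma>"
      using False by (simp add: d_def \<gamma>_def)
    ultimately show ?thesis
      using nonneg[of x y] nonneg[of y z] by (auto simp: not_less intro: add_increasing add_increasing2)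
  qed
  moreover have "d x y = 0 \<longleftrightarrow> x = y" if "x \<in> ?M" "y \<in> ?M" for x y
    using that pos inj_onD[OF embedding_inj[OF f]] by (auto simp: d_def) (metis less_irrefl)
  moreover have "d x y = d y x" for x y
    by (simp add: d_def eq_commute)
  ultimately have metric: "group_metric_on ?M d"
    using nonneg unfolding group_metric_on_def by blast
  have top_iff: "openin (group_metric_topology ?M d) U \<longleftrightarrow> openin X U" for U
  proof
    assume "openin (group_metric_topology ?M d) U"
    then have U: "U \<subseteq> ?M" "\<And>x. x \<in> U \<Longrightarrow> \<exists>\<epsilon>>0. \<forall>y\<in>?M. d x y < \<epsilon> \<longrightarrow> y \<in> U"
      by (auto simp: openin_group_metric_iff[OF metric])
    show "openin X U"
    proof (subst openin_subopen, intro ballI)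
      fix x assume x: "x \<in> U"
      obtain \<epsilon> where \<epsilon>: "\<epsilon> > 0" "\<forall>y\<in>?M. d x y < \<epsilon> \<longrightarrow> y \<in> U"
        using U(2)[OF x] by blast
      obtain \<alpha> where \<alpha>: "e \<alpha> \<le> \<epsilon>"
        using coin \<epsilon>(1) by blast
      obtain \<beta> where \<beta>: "\<alpha> < \<beta>"
        using above by blast
      obtain V where V: "openin X V" "x \<in> V" "\<forall>y\<in>V. agree \<beta> (f x) (f y)"
        using embedding_cont[OF f, of x \<beta>] x U(1) by blast
      have "y \<in> U" if y: "y \<in> V" for y
      proof -
        have "d x y < e \<alpha>"
          using V(3) y \<beta> by (auto simp: d_less agree_def)
        then show ?thesis
          using \<alpha> \<epsilon>(2) y openin_subset[OF V(1)] by (meson less_le_trans subsetD)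
      qed
      with V(1,2) show "\<exists>T. openin X T \<and> x \<in> T \<and> T \<subseteq> U"
        by blast
    qed
  next
    assume U: "openin X U"
    have "\<exists>\<epsilon>>0. \<forall>y\<in>?M. d x y < \<epsilon> \<longrightarrow> y \<in> U" if x: "x \<in> U" for x
    proof -
      obtain \<alpha> where "\<forall>y\<in>?M. agree \<alpha> (f x) (f y) \<longrightarrow> y \<in> U"
        using embedding_nbhd[OF f U x] by blast
      then show ?thesis
        using pos by (intro exI[of _ "e \<alpha>"]) (auto simp: d_less agree_def)
    qed
    then show "openin (group_metric_topology ?M d) U"
      using openin_subset[OF U] by (auto simp: openin_group_metric_iff[OF metric])
  qed
  then have top: "group_metric_topology ?M d = X"
    by (simp add: topology_eq)
  have "\<exists>l. limitin X s l at_top" if s: "range s \<subseteq> ?M" "group_Cauchy d s" for s :: "'k \<Rightarrow> 'x"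
  proof -
    have "\<exists>A. \<forall>\<beta>\<ge>A. \<forall>\<gamma>\<ge>A. d (s \<beta>) (s \<gamma>) < e \<alpha>" for \<alpha>
      using s(2) pos by (simp add: group_Cauchy_def)
    then obtain A where A: "\<And>\<alpha> \<beta> \<gamma>. \<beta> \<ge> A \<alpha> \<Longrightarrow> \<gamma> \<ge> A \<alpha> \<Longrightarrow> d (s \<beta>) (s \<gamma>) < e \<alpha>"
      by metis
    \<comment> \<open>From \<open>A \<alpha>\<close> on, the coordinates up to \<open>\<alpha>\<close> no longer change.\<close>
    define y where "y \<alpha> = f (s (A \<alpha>)) \<alpha>" for \<alpha>
    have tail: "f (s \<delta>) \<beta> = y \<beta>" if "\<delta> \<ge> A \<alpha>" "\<beta> \<le> \<alpha>" for \<alpha> \<beta> \<delta>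
    proof -
      let ?\<delta>' = "max \<delta> (A \<beta>)"
      have "f (s \<delta>) \<beta> = f (s ?\<delta>') \<beta>"
        using A[of \<alpha> \<delta> ?\<delta>'] that by (simp add: d_less le_max_iff_disj)
      also have "\<dots> = y \<beta>"
        using A[of \<beta> ?\<delta>' "A \<beta>"] by (simp add: d_less y_def)
      finally show ?thesis .
    qed
    have "\<exists>z\<in>f ` ?M. agree \<alpha> y z" for \<alpha>
    proof
      show "agree \<alpha> y (f (s (A \<alpha>)))"
        using tail[of \<alpha> "A \<alpha>"] by (simp add: agree_def)
      show "f (s (A \<alpha>)) \<in> f ` ?M"
        using s(1) by blast
    qed
    then obtain l where l: "l \<in> ?M" "f l = y"
      using closed unfolding closedin_bounded_iff by blast
    have "\<forall>\<^sub>F \<delta> in at_top. s \<delta> \<in> U" if U: "openin X U" "l \<in> U" for U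
    proof -
      obtain \<alpha> where \<alpha>: "\<forall>z\<in>?M. agree \<alpha> (f l) (f z) \<longrightarrow> z \<in> U"
        using embedding_nbhd[OF f U] by blast
      have "s \<delta> \<in> U" if "\<delta> \<ge> A \<alpha>" for \<delta>
      proof -
        have "s \<delta> \<in> ?M"
          using s(1) by blast
        moreover have "agree \<alpha> (f l) (f (s \<delta>))"
          using tail[OF that] l(2) by (simp add: agree_def)
        ultimately show ?thesis
          using \<alpha> by blast
      qed
      then show ?thesis
        by (auto simp: eventually_at_top_linorder)
    qed
    then show ?thesis
      using l(1) by (auto simp: limitin_def)
  qed
  then have "Cauchy_complete_on k ?M d"
    by (simp add: Cauchy_complete_on_def top)
  then show ?thesis
    using metric top embedding_imp_weight_le[OF f] unfolding group_Polish_def by blast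
qed

text \<open>
  A point in the intersection of fewer than \<open>\<kappa>\<close> open sets comes with fewer than \<open>\<kappa>\<close> radii, and these have a common
  positive lower bound.
\<close>

lemma group_metric_additive:
  fixes d :: "'x \<Rightarrow> 'x \<Rightarrow> 'g"
  assumes d: "group_metric_on M d"
  shows "additive_space (kappa :: 'k rel) (group_metric_topology M d)"
  unfolding additive_space_def
proof (intro allI impI, elim conjE)
  let ?X = "group_metric_topology M d"
  fix \<U> assume small: "|\<U>| <o (kappa :: 'k rel)" and opn: "\<forall>U\<in>\<U>. openin ?X U"
  have top: "topspace ?X = M"
  proof
    show "topspace ?X \<subseteq> M"
      using openin_group_metric_iff[OF d] openin_topspace by blast
    obtain a :: 'g where "a > 0"
      using small_lower_bound[OF countable_less_kappa, of "{}"] by auto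
    then have "openin ?X M"
      by (auto simp: openin_group_metric_iff[OF d])
    then show "M \<subseteq> topspace ?X"
      by (rule openin_subset)
  qed
  have "\<exists>\<epsilon>>0. \<forall>y\<in>M. d x y < \<epsilon> \<longrightarrow> y \<in> M \<inter> \<Inter>\<U>" if x: "x \<in> M \<inter> \<Inter>\<U>" for x
  proof -
    have "\<forall>U\<in>\<U>. \<exists>\<epsilon>>0. \<forall>y\<in>M. d x y < \<epsilon> \<longrightarrow> y \<in> U"
      using opn x by (auto simp: openin_group_metric_iff[OF d])
    then obtain r where r: "\<And>U. U \<in> \<U> \<Longrightarrow> r U > 0" "\<And>U y. U \<in> \<U> \<Longrightarrow> y \<in> M \<Longrightarrow> d x y < r U \<Longrightarrow> y \<in> U"
      by metis
    have "|r ` \<U>| <o (kappa :: 'k rel)"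
      using small card_of_image ordLeq_ordLess_trans by blast
    then obtain a where "a > 0" "\<forall>e\<in>r ` \<U>. a < e"
      using small_lower_bound[of "r ` \<U>"] r(1) by blast
    then show ?thesis
      using r(2) by (intro exI[of _ a]) (auto dest: order.strict_trans)
  qed
  then show "openin ?X (topspace ?X \<inter> \<Inter>\<U>)"
    by (auto simp: openin_group_metric_iff[OF d] top)
qed

end

section \<open>A winning strategy from a complete metric\<close>

context deg_group
begin

text \<open>
  In round \<open>\<alpha>\<close>, player II answers \<open>(U, x)\<close> with an open ball around \<open>x\<close> whose radius is at most \<open>e \<alpha>\<close>
  and whose closed ball is inside \<open>U\<close>, where \<open>e\<close> is a coinitial family of positive elements. Since the
  space is \<open>\<kappa>\<close>-additive, the arenas are open and such a ball exists. If the run is not ended at a limit,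
  the centres form a Cauchy sequence. Their limit is in each closed ball, hence in each \<open>U \<alpha>\<close>, hence in
  the balls played before \<open>\<alpha>\<close>.
\<close>

lemma group_Polish_imp_additive_fSC:
  fixes X :: "'x topology"
  assumes "group_Polish k g X"
  shows "additive_space (kappa :: 'k rel) X" "fSC_space k X"
proof -
  let ?M = "topspace X"
  obtain d :: "'x \<Rightarrow> 'x \<Rightarrow> 'g" where d: "group_metric_on ?M d"
    and top: "group_metric_topology ?M d = X" and complete: "Cauchy_complete_on k ?M d"
    using assms by (auto simp: group_Polish_def)
  have weight: "weight_le X (kappa :: 'k rel)"
    using assms by (simp add: group_Polish_def)
  show additive: "additive_space (kappa :: 'k rel) X"
    using group_metric_additive[OF d] top by simp
  have dself: "d x x = 0" if "x \<in> ?M" for x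
    using d that by (simp add: group_metric_on_def)
  have dsym: "d x y = d y x" if "x \<in> ?M" "y \<in> ?M" for x y
    using d that by (auto simp: group_metric_on_def)
  have dtri: "d x z \<le> d x y + d y z" if "x \<in> ?M" "y \<in> ?M" "z \<in> ?M" for x y z
    using d that by (auto simp: group_metric_on_def)
  obtain e :: "'k \<Rightarrow> 'g" where pos: "\<And>\<alpha>. 0 < e \<alpha>" and coin: "\<And>\<epsilon>. \<epsilon> > 0 \<Longrightarrow> \<exists>\<alpha>. e \<alpha> \<le> \<epsilon>"
    using coinitial_enumeration by blast
  define r where
    "r \<alpha> U x = (SOME \<delta>. 0 < \<delta> \<and> \<delta> \<le> e \<alpha> \<and> (\<forall>y\<in>?M. d x y \<le> \<delta> \<longrightarrow> y \<in> U))" for \<alpha> U x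
  have r: "0 < r \<alpha> U x \<and> r \<alpha> U x \<le> e \<alpha> \<and> (\<forall>y\<in>?M. d x y \<le> r \<alpha> U x \<longrightarrow> y \<in> U)"
    if U: "openin X U" "x \<in> U" for \<alpha> U x
  proof -
    obtain \<epsilon> where \<epsilon>: "0 < \<epsilon>" "\<forall>y\<in>?M. d x y < \<epsilon> \<longrightarrow> y \<in> U"
      using U openin_group_metric_iff[OF d, of U] top by auto
    obtain \<delta> where \<delta>: "0 < \<delta>" "\<delta> + \<delta> \<le> \<epsilon>"
      using halving[OF \<epsilon>(1)] by blast
    have "\<delta> < \<delta> + \<delta>"
      using \<delta>(1) by simp
    also note \<delta>(2)
    finally have "\<delta> < \<epsilon>" .
    then have "0 < min \<delta> (e \<alpha>) \<and> min \<delta> (e \<alpha>) \<le> e \<alpha> \<and> (\<forall>y\<in>?M. d x y \<le> min \<delta> (e \<alpha>) \<longrightarrow> y \<in> U)"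
      using \<delta>(1) pos \<epsilon>(2) by auto
    then show ?thesis
      unfolding r_def by (rule someI)
  qed
  define \<sigma> :: "'k \<Rightarrow> ('k \<Rightarrow> 'x set \<times> 'x) \<Rightarrow> ('k \<Rightarrow> 'x set) \<Rightarrow> 'x set" where
    "\<sigma> \<alpha> p V = {y\<in>?M. d (snd (p \<alpha>)) y < r \<alpha> (fst (p \<alpha>)) (snd (p \<alpha>))}" for \<alpha> p V
  have "winning_strategy_II X \<sigma>"
    unfolding winning_strategy_II_def
  proof (intro allI impI)
    fix p and V :: "'k \<Rightarrow> 'x set"
    assume run: "\<forall>\<alpha>. V \<alpha> = \<sigma> \<alpha> (restrict p {..\<alpha>}) (restrict V {..<\<alpha>})"
    define U where "U \<alpha> = fst (p \<alpha>)" for \<alpha>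
    define x where "x \<alpha> = snd (p \<alpha>)" for \<alpha>
    define \<rho> where "\<rho> \<alpha> = r \<alpha> (U \<alpha>) (x \<alpha>)" for \<alpha>
    have V: "V \<alpha> = {y\<in>?M. d (x \<alpha>) y < \<rho> \<alpha>}" for \<alpha>
      using run[rule_format, of \<alpha>] by (simp add: \<sigma>_def U_def x_def \<rho>_def)
    have legal: "openin X (V \<alpha>) \<and> openin X (U \<alpha>) \<and> U \<alpha> \<subseteq> game_arena X V \<alpha> \<and> x \<alpha> \<in> V \<alpha> \<and> V \<alpha> \<subseteq> U \<alpha> \<and>
        0 < \<rho> \<alpha> \<and> \<rho> \<alpha> \<le> e \<alpha> \<and> (\<forall>y\<in>?M. d (x \<alpha>) y \<le> \<rho> \<alpha> \<longrightarrow> y \<in> U \<alpha>)"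
      if legal_I: "\<forall>\<beta>\<le>\<alpha>. legal_I X p V \<beta>" for \<alpha>
    proof -
      have xM: "x \<beta> \<in> ?M" if "\<beta> \<le> \<alpha>" for \<beta>
        using legal_I that openin_subset[of _ "U \<beta>"] by (force simp: legal_I_def U_def x_def)
      then have V_open: "openin X (V \<beta>)" if "\<beta> \<le> \<alpha>" for \<beta>
        using openin_group_ball[OF d, of "x \<beta>"] that by (simp add: V top)
      then have "openin X (game_arena X V \<alpha>)"
        by (intro openin_Inter_below[OF additive]) auto
      then have U: "openin X (U \<alpha>)" "U \<alpha> \<subseteq> game_arena X V \<alpha>"
        using legal_I[rule_format, of \<alpha>] by (simp_all add: legal_I_def U_def openin_open_subtopology)
      moreover have x: "x \<alpha> \<in> U \<alpha>"
        using legal_I by (auto simp: legal_I_def U_def x_def)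
      ultimately have \<rho>: "0 < \<rho> \<alpha> \<and> \<rho> \<alpha> \<le> e \<alpha> \<and> (\<forall>y\<in>?M. d (x \<alpha>) y \<le> \<rho> \<alpha> \<longrightarrow> y \<in> U \<alpha>)"
        unfolding \<rho>_def by (intro r)
      then have "V \<alpha> \<subseteq> U \<alpha>" "x \<alpha> \<in> V \<alpha>"
        using xM dself by (auto simp: V)
      with V_open U \<rho> show ?thesis
        by blast
    qed
    have "legal_II X p V \<alpha>" if "\<forall>\<beta>\<le>\<alpha>. legal_I X p V \<beta>" for \<alpha>
    proof -
      have "V \<alpha> \<subseteq> game_arena X V \<alpha>"
        using legal[OF that] by blast
      then have "V \<alpha> = V \<alpha> \<inter> game_arena X V \<alpha>"
        by blast
      then have "openin (subtopology X (game_arena X V \<alpha>)) (V \<alpha>)"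
        using legal[OF that] openin_subtopology by blast
      then show ?thesis
        using legal[OF that] by (auto simp: legal_II_def U_def x_def)
    qed
    moreover have "II_wins X V" if fair: "\<forall>\<alpha>. \<not> ended_by X V \<alpha> \<longrightarrow> legal_I X p V \<alpha>"
    proof (cases "\<exists>\<gamma>. ended_by X V \<gamma>")
      case True
      then show ?thesis
        by (simp add: II_wins_def)
    next
      case False
      have L: "openin X (V \<alpha>)" "U \<alpha> \<subseteq> game_arena X V \<alpha>" "x \<alpha> \<in> V \<alpha>" "V \<alpha> \<subseteq> U \<alpha>"
        "\<rho> \<alpha> \<le> e \<alpha>" "\<And>y. y \<in> ?M \<Longrightarrow> d (x \<alpha>) y \<le> \<rho> \<alpha> \<Longrightarrow> y \<in> U \<alpha>" for \<alpha>
        using legal[of \<alpha>] False fair by auto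
      have xM: "x \<alpha> \<in> ?M" for \<alpha>
        using L(1,3) openin_subset by blast
      have U_V: "U \<beta> \<subseteq> V \<alpha>" if "\<alpha> < \<beta>" for \<alpha> \<beta>
        using L(2)[of \<beta>] that by (auto simp: game_arena_def)
      have later: "x \<beta> \<in> V \<alpha>" if "\<alpha> \<le> \<beta>" for \<alpha> \<beta>
        using U_V[of \<alpha> \<beta>] L(3)[of \<beta>] L(4)[of \<beta>] that unfolding le_less by auto
      have "group_Cauchy d x"
        unfolding group_Cauchy_def
      proof (intro allI impI)
        fix \<epsilon> :: 'g assume "\<epsilon> > 0"
        then obtain \<delta> where \<delta>: "\<delta> > 0" "\<delta> + \<delta> \<le> \<epsilon>"
          using halving by blast
        obtain \<alpha> where \<alpha>: "e \<alpha> \<le> \<delta>"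
          using coin[OF \<delta>(1)] by blast
        have "d (x \<beta>) (x \<gamma>) < \<epsilon>" if "\<beta> \<ge> \<alpha>" "\<gamma> \<ge> \<alpha>" for \<beta> \<gamma>
        proof -
          have "d (x \<beta>) (x \<gamma>) \<le> d (x \<alpha>) (x \<beta>) + d (x \<alpha>) (x \<gamma>)"
            using dtri[of "x \<beta>" "x \<alpha>" "x \<gamma>"] xM dsym by simp
          also have "\<dots> < \<rho> \<alpha> + \<rho> \<alpha>"
            using later[OF that(1)] later[OF that(2)] by (intro add_strict_mono) (auto simp: V)
          also have "\<dots> \<le> \<delta> + \<delta>"
            using L(5)[of \<alpha>] \<alpha> by (intro add_mono) auto
          finally show ?thesis
            using \<delta>(2) by simp
        qed
        then show "\<exists>\<alpha>. \<forall>\<beta>\<ge>\<alpha>. \<forall>\<gamma>\<ge>\<alpha>. d (x \<beta>) (x \<gamma>) < \<epsilon>"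
          by blast
      qed
      then obtain l where l: "limitin X x l at_top"
        using complete xM top by (auto simp: Cauchy_complete_on_def)
      then have lM: "l \<in> ?M"
        by (simp add: limitin_def)
      \<comment> \<open>Otherwise some late centre is too close to \<open>l\<close> to be in the ball of round \<open>\<alpha>\<close>.\<close>
      have "l \<in> U \<alpha>" for \<alpha>
      proof (rule L(6)[OF lM], rule ccontr)
        assume "\<not> d (x \<alpha>) l \<le> \<rho> \<alpha>"
        then have "l \<in> {y\<in>?M. d l y < d (x \<alpha>) l - \<rho> \<alpha>}"
          using lM dself by (simp add: not_le)
        moreover have "openin X {y\<in>?M. d l y < d (x \<alpha>) l - \<rho> \<alpha>}"
          using openin_group_ball[OF d lM] top by simp
        ultimately have "\<forall>\<^sub>F \<beta> in at_top. x \<beta> \<in> {y\<in>?M. d l y < d (x \<alpha>) l - \<rho> \<alpha>}"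
          using l unfolding limitin_def by blast
        then obtain A where A: "\<And>\<beta>. \<beta> \<ge> A \<Longrightarrow> d l (x \<beta>) < d (x \<alpha>) l - \<rho> \<alpha>"
          by (auto simp: eventually_at_top_linorder)
        define \<beta> where "\<beta> = max A \<alpha>"
        have "d (x \<alpha>) l \<le> d (x \<alpha>) (x \<beta>) + d l (x \<beta>)"
          using dtri[of "x \<alpha>" "x \<beta>" l] dsym[of l "x \<beta>"] xM lM by simp
        also have "\<dots> < \<rho> \<alpha> + (d (x \<alpha>) l - \<rho> \<alpha>)"
          using later[of \<alpha> \<beta>] A[of \<beta>] by (intro add_strict_mono) (auto simp: V \<beta>_def)
        finally show False
          by simp
      qed
      then have "l \<in> V \<alpha>" for \<alpha>
        using above[of \<alpha>] U_V by blast
      then show ?thesis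
        by (auto simp: II_wins_def)
    qed
    ultimately show "(\<forall>\<alpha>. (\<forall>\<beta>\<le>\<alpha>. legal_I X p V \<beta>) \<longrightarrow> legal_II X p V \<alpha>) \<and>
        ((\<forall>\<alpha>. \<not> ended_by X V \<alpha> \<longrightarrow> legal_I X p V \<alpha>) \<longrightarrow> II_wins X V)"
      by blast
  qed
  with weight show "fSC_space k X"
    unfolding fSC_space_def by blast
qed

end

section \<open>Clopen bases\<close>

context strong_cardinal
begin

text \<open>
  Alternate open and closed neighbourhoods of \<open>x\<close> for \<open>\<omega>\<close> steps, each inside the one before. Their
  intersection is closed, and it is open because \<open>\<omega> < \<kappa>\<close>.
\<close>

lemma clopen_neighbourhood:
  assumes additive: "additive_space (kappa :: 'k rel) X" and "regular_space X"
    and W: "openin X W" "x \<in> W"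
  shows "\<exists>K. openin X K \<and> closedin X K \<and> x \<in> K \<and> K \<subseteq> W"
proof -
  have "neighbourhood_base_of (closedin X) X"
    using assms(2) by (simp add: neighbourhood_base_of_closedin)
  then have "\<exists>U V. openin X U \<and> closedin X V \<and> x \<in> U \<and> U \<subseteq> V \<and> V \<subseteq> W"
    if "openin X W" "x \<in> W" for W
    using that unfolding neighbourhood_base_of by blast
  then obtain F G where FG: "\<And>W. openin X W \<Longrightarrow> x \<in> W \<Longrightarrow>
      openin X (F W) \<and> closedin X (G W) \<and> x \<in> F W \<and> F W \<subseteq> G W \<and> G W \<subseteq> W"
    by metis
  define u where "u n = (F ^^ n) W" for n
  have u: "openin X (u n) \<and> x \<in> u n" for n
    by (induction n) (use W FG in \<open>auto simp: u_def\<close>)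
  have step: "u (Suc n) \<subseteq> G (u n) \<and> G (u n) \<subseteq> u n \<and> closedin X (G (u n))" for n
    using FG[of "u n"] u[of n] by (simp add: u_def)
  define K where "K = topspace X \<inter> \<Inter>(range u)"
  have "openin X K"
    unfolding K_def by (rule openin_Inter_small[OF additive]) (use u countable_less_kappa[of "range u"] in auto)
  moreover have "K = (\<Inter>n. G (u n))"
  proof
    show "K \<subseteq> (\<Inter>n. G (u n))"
      using step unfolding K_def by blast
    show "(\<Inter>n. G (u n)) \<subseteq> K"
      using step closedin_subset[of X "G (u 0)"] unfolding K_def by blast
  qed
  then have "closedin X K"
    using step by (simp add: closedin_INT)
  moreover have "x \<in> K"
    using u openin_subset[OF W(1)] W(2) by (auto simp: K_def)
  moreover have "K \<subseteq> u 0"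
    unfolding K_def by blast
  ultimately show ?thesis
    by (auto simp: u_def)
qed

text \<open>
  To keep the base of size \<open>\<kappa>\<close>, one clopen set is selected between any two members of a given base of
  size \<open>\<kappa>\<close> that admit one. For pairs that do not, the empty set is put in.
\<close>

lemma enumerated_clopen_base:
  assumes additive: "additive_space (kappa :: 'k rel) X" and regular: "regular_space X"
    and weight: "weight_le X (kappa :: 'k rel)"
  shows "\<exists>Z :: 'k \<Rightarrow> 'x set. (\<forall>i. openin X (Z i) \<and> closedin X (Z i)) \<and>
    (\<forall>U x. openin X U \<and> x \<in> U \<longrightarrow> (\<exists>i. x \<in> Z i \<and> Z i \<subseteq> U))"
proof -
  obtain B :: "'k \<Rightarrow> 'x set" where "(\<forall>i. openin X (B i)) \<and>
      (\<forall>U x. openin X U \<and> x \<in> U \<longrightarrow> (\<exists>i. x \<in> B i \<and> B i \<subseteq> U))"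
    using weight unfolding weight_le_iff_enumerated_base by (elim exE)
  then have B: "openin X (B i)" "openin X U \<Longrightarrow> x \<in> U \<Longrightarrow> \<exists>i. x \<in> B i \<and> B i \<subseteq> U" for i U x
    by simp_all
  obtain pr :: "'k \<times> 'k \<Rightarrow> 'k" where pr: "bij pr"
    using pairing by blast
  define between where "between i j K \<longleftrightarrow> openin X K \<and> closedin X K \<and> B i \<subseteq> K \<and> K \<subseteq> B j" for i j K
  define Y where "Y i j = (if \<exists>K. between i j K then SOME K. between i j K else {})" for i j
  have Y: "openin X (Y i j) \<and> closedin X (Y i j)" for i j
  proof (cases "\<exists>K. between i j K")
    case True
    then have "between i j (SOME K. between i j K)"
      by (rule someI_ex)
    with True show ?thesis
      by (simp add: Y_def between_def[of i j "SOME K. between i j K"])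
  qed (simp add: Y_def)
  define Z where "Z i = (\<lambda>(a, b). Y a b) (inv pr i)" for i
  have Z_pr: "Z (pr (a, b)) = Y a b" for a b
    using pr by (simp add: Z_def bij_is_inj inv_f_f)
  have "openin X (Z i) \<and> closedin X (Z i)" for i
    using Y by (simp add: Z_def split_beta)
  moreover have "\<exists>i. x \<in> Z i \<and> Z i \<subseteq> U" if U: "openin X U" "x \<in> U" for U x
  proof -
    obtain j where j: "x \<in> B j" "B j \<subseteq> U"
      using B(2)[OF U] by blast
    obtain K where K: "openin X K" "closedin X K" "x \<in> K" "K \<subseteq> B j"
      using clopen_neighbourhood[OF additive regular B(1) j(1)] by blast
    obtain i where i: "x \<in> B i" "B i \<subseteq> K"
      using B(2)[OF K(1,3)] by blast
    have ex: "\<exists>K. between i j K"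
      using K i by (auto simp: between_def)
    then have "between i j (SOME K. between i j K)"
      by (rule someI_ex)
    then have "between i j (Y i j)"
      using ex by (simp add: Y_def)
    then have "x \<in> Y i j" "Y i j \<subseteq> U"
      using i j by (auto simp: between_def)
    then show ?thesis
      by (intro exI[of _ "pr (i, j)"]) (simp add: Z_pr)
  qed
  ultimately show ?thesis
    by (intro exI[of _ Z]) blast
qed

section \<open>The tree of runs of the game\<close>

text \<open>
  Whether a strategy is winning is defined by runs of length \<open>\<kappa>\<close>. A partial run that follows the strategy
  can be prolonged to such a run, so that the legality of the replies is also available while a
  run is being constructed.
\<close>

lemma legal_II_if_partial_run:
  fixes X :: "'x topology" and \<alpha> :: 'k
  assumes \<sigma>: "winning_strategy_II X \<sigma>"
    and run: "\<And>\<beta>. \<beta> \<le> \<alpha> \<Longrightarrow> V \<beta> = \<sigma> \<beta> (restrict p {..\<beta>}) (restrict V {..<\<beta>})"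
    and legal: "\<And>\<beta>. \<beta> \<le> \<alpha> \<Longrightarrow> legal_I X p V \<beta>"
  shows "legal_II X p V \<alpha>"
proof -
  have "\<exists>V'. \<forall>\<beta>. V' \<beta> = \<sigma> \<beta> (restrict p {..\<beta>}) (restrict V' {..<\<beta>})"
  proof (rule dependent_wellorder_choice)
    fix r and f g :: "'k \<Rightarrow> 'x set" and \<beta> assume "\<And>\<gamma>. \<gamma> < \<beta> \<Longrightarrow> f \<gamma> = g \<gamma>"
    then have "restrict f {..<\<beta>} = restrict g {..<\<beta>}"
      by (intro restrict_ext) simp
    then show "(r = \<sigma> \<beta> (restrict p {..\<beta>}) (restrict f {..<\<beta>})) =
        (r = \<sigma> \<beta> (restrict p {..\<beta>}) (restrict g {..<\<beta>}))"
      by simp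
  qed simp
  then obtain V' where V': "\<And>\<beta>. V' \<beta> = \<sigma> \<beta> (restrict p {..\<beta>}) (restrict V' {..<\<beta>})"
    by blast
  have eq: "V' \<beta> = V \<beta>" if "\<beta> \<le> \<alpha>" for \<beta>
    using that
  proof (induction \<beta> rule: less_induct)
    case (less \<beta>)
    then have "restrict V' {..<\<beta>} = restrict V {..<\<beta>}"
      by (intro restrict_ext) simp
    then show ?case
      using V'[of \<beta>] run[OF less.prems] by simp
  qed
  have arena: "game_arena X V' \<beta> = game_arena X V \<beta>" if "\<beta> \<le> \<alpha>" for \<beta>
    using eq that by (auto simp: game_arena_def)
  have "legal_I X p V' \<beta>" if "\<beta> \<le> \<alpha>" for \<beta>
    using legal[OF that] arena[OF that] by (simp add: legal_I_def)
  then have "legal_II X p V' \<alpha>"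
    using \<sigma> V' unfolding winning_strategy_II_def by blast
  then show ?thesis
    using arena eq by (simp add: legal_II_def)
qed

end

type_synonym ('a, 'b) history = "'a \<Rightarrow> ('b set \<times> 'b) \<times> 'b set \<times> 'b set"

text \<open>
  Every \<open>b\<close> from \<open>\<kappa>\<close> to \<open>\<kappa>\<close> determines a run in which II follows the winning strategy \<open>\<sigma>\<close>. A history
  records for each round the move of I, the reply of II, and the piece chosen inside this reply. The
  cell of round \<open>\<alpha>\<close> is the intersection of the pieces chosen before; in these runs it is contained
  in the arena of round \<open>\<alpha>\<close>. For each point \<open>x\<close> of the cell, I could play
  \<open>x\<close> with those points of the cell that are on the same side of the clopen set \<open>Z \<alpha>\<close> as \<open>x\<close>. The replies
  of II to these moves cover the cell. They are refined to a partition of the cell into open pieces,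
  indexed by \<open>\<kappa>\<close>, and \<open>b \<alpha>\<close> says which piece to take. The move actually played by I in
  round \<open>\<alpha>\<close> is one whose reply contains the piece taken.

  As each cell is partitioned, every point of the space follows exactly one branch. As \<open>Z \<alpha>\<close> is decided in
  round \<open>\<alpha>\<close>, the cells along a branch form a neighbourhood base at each of their common points. As II wins,
  a branch with nonempty cells has a common point.
\<close>

locale choquet_tree = strong_cardinal k for k :: "'k::wellorder itself" +
  fixes X :: "'x topology"
    and \<sigma> :: "'k \<Rightarrow> ('k \<Rightarrow> 'x set \<times> 'x) \<Rightarrow> ('k \<Rightarrow> 'x set) \<Rightarrow> 'x set"
    and Z :: "'k \<Rightarrow> 'x set"
  assumes additive: "additive_space (kappa :: 'k rel) X"
    and Hausdorff: "Hausdorff_space X"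
    and winning: "winning_strategy_II X \<sigma>"
    and Z_open: "openin X (Z i)" and Z_closed: "closedin X (Z i)"
    and Z_base: "openin X U \<Longrightarrow> x \<in> U \<Longrightarrow> \<exists>i. x \<in> Z i \<and> Z i \<subseteq> U"
begin



definition I_moves :: "('k, 'x) history \<Rightarrow> 'k \<Rightarrow> 'x set \<times> 'x" where
  "I_moves h \<alpha> = fst (h \<alpha>)"

definition II_moves :: "('k, 'x) history \<Rightarrow> 'k \<Rightarrow> 'x set" where
  "II_moves h \<alpha> = fst (snd (h \<alpha>))"

definition chosen :: "('k, 'x) history \<Rightarrow> 'k \<Rightarrow> 'x set" where
  "chosen h \<alpha> = snd (snd (h \<alpha>))"

definition cell :: "('k, 'x) history \<Rightarrow> 'k \<Rightarrow> 'x set" where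
  "cell h \<alpha> = game_arena X (chosen h) \<alpha>"

text \<open>
  Restricting I to one side of \<open>Z \<alpha>\<close> makes every later cell contained in \<open>Z \<alpha>\<close> or disjoint from it.
\<close>

definition side :: "'k \<Rightarrow> 'x \<Rightarrow> 'x set" where
  "side \<alpha> x = (if x \<in> Z \<alpha> then Z \<alpha> else topspace X - Z \<alpha>)"

definition I_move :: "('k, 'x) history \<Rightarrow> 'k \<Rightarrow> 'x \<Rightarrow> 'x set \<times> 'x" where
  "I_move h \<alpha> x = (cell h \<alpha> \<inter> side \<alpha> x, x)"

definition reply :: "('k, 'x) history \<Rightarrow> 'k \<Rightarrow> 'x \<Rightarrow> 'x set" where
  "reply h \<alpha> x = \<sigma> \<alpha> (restrict ((I_moves h)(\<alpha> := I_move h \<alpha> x)) {..\<alpha>}) (restrict (II_moves h) {..<\<alpha>})"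

text \<open>
  The part of the cell in \<open>Z i\<close> may be used as a piece if it is contained in the reply to
  the move of I at some point \<open>x\<close> of the cell.
\<close>

definition fits :: "('k, 'x) history \<Rightarrow> 'k \<Rightarrow> 'k \<Rightarrow> 'x \<Rightarrow> bool" where
  "fits h \<alpha> i x \<longleftrightarrow> x \<in> cell h \<alpha> \<and> Z i \<inter> cell h \<alpha> \<subseteq> reply h \<alpha> x"

text \<open>
  The usual disjointification: a point goes to the first fitting \<open>Z i\<close> that contains it. Each piece is
  open because the \<open>Z j\<close> are closed and there are fewer than \<open>\<kappa>\<close> indices below \<open>i\<close>.
\<close>

definition piece :: "('k, 'x) history \<Rightarrow> 'k \<Rightarrow> 'k \<Rightarrow> 'x set" where
  "piece h \<alpha> i = {y \<in> cell h \<alpha>. y \<in> Z i \<and> (\<exists>x. fits h \<alpha> i x) \<and> (\<forall>j<i. (\<exists>x. fits h \<alpha> j x) \<longrightarrow> y \<notin> Z j)}"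

text \<open>
  If no point fits \<open>i\<close>, the choice of \<open>x\<close> is arbitrary, but then the piece is empty and the branch
  dies.
\<close>

definition next_round :: "('k, 'x) history \<Rightarrow> 'k \<Rightarrow> 'k \<Rightarrow> ('x set \<times> 'x) \<times> 'x set \<times> 'x set" where
  "next_round h \<alpha> i = (let x = SOME x. fits h \<alpha> i x in (I_move h \<alpha> x, reply h \<alpha> x, piece h \<alpha> i))"

definition run :: "('k \<Rightarrow> 'k) \<Rightarrow> ('k, 'x) history" where
  "run b = wfrec {(\<beta>, \<alpha>). \<beta> < \<alpha>} (\<lambda>h \<alpha>. next_round h \<alpha> (b \<alpha>))"

definition node :: "('k \<Rightarrow> 'k) \<Rightarrow> 'k \<Rightarrow> 'x set" where
  "node b = cell (run b)"

text \<open>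
  Round \<open>\<alpha>\<close> is a function of the rounds before \<open>\<alpha>\<close>. This justifies the recursion, and it implies
  that the cell at \<open>\<alpha>\<close> and its partition depend only on the restriction of \<open>b\<close> to \<open>\<alpha>\<close>.
\<close>

lemma history_cong:
  assumes "\<And>\<beta>. \<beta> < \<alpha> \<Longrightarrow> h \<beta> = h' \<beta>"
  shows "cell h \<alpha> = cell h' \<alpha>" "reply h \<alpha> = reply h' \<alpha>" "piece h \<alpha> = piece h' \<alpha>"
    "next_round h \<alpha> = next_round h' \<alpha>"
proof -
  show cell: "cell h \<alpha> = cell h' \<alpha>"
    using assms by (simp add: cell_def game_arena_def chosen_def)
  then have I_move: "I_move h \<alpha> = I_move h' \<alpha>"
    by (simp add: I_move_def fun_eq_iff)
  have "restrict ((I_moves h)(\<alpha> := m)) {..\<alpha>} = restrict ((I_moves h')(\<alpha> := m)) {..\<alpha>}" for m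
    using assms by (intro restrict_ext) (simp add: I_moves_def)
  moreover have "restrict (II_moves h) {..<\<alpha>} = restrict (II_moves h') {..<\<alpha>}"
    using assms by (intro restrict_ext) (simp add: II_moves_def)
  ultimately have "reply h \<alpha> x = reply h' \<alpha> x" for x
    by (simp only: reply_def I_move)
  then show reply: "reply h \<alpha> = reply h' \<alpha>"
    by (rule ext)
  have fits: "fits h \<alpha> = fits h' \<alpha>"
    by (simp add: fits_def fun_eq_iff cell reply)
  show piece: "piece h \<alpha> = piece h' \<alpha>"
    by (simp add: piece_def fun_eq_iff cell fits)
  show "next_round h \<alpha> = next_round h' \<alpha>"
    by (simp add: next_round_def fun_eq_iff fits I_move reply piece)
qed

lemma run_unfold: "run b \<alpha> = next_round (run b) \<alpha> (b \<alpha>)"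
proof -
  let ?R = "{(\<beta>, \<alpha>). \<beta> < \<alpha>} :: ('k \<times> 'k) set"
  have "run b \<alpha> = next_round (cut (run b) ?R \<alpha>) \<alpha> (b \<alpha>)"
    unfolding run_def by (subst wfrec) (auto simp: wf)
  also have "next_round (cut (run b) ?R \<alpha>) \<alpha> = next_round (run b) \<alpha>"
    by (rule history_cong) (simp add: cut_apply)
  finally show ?thesis .
qed

lemma run_cong: "agree \<alpha> b b' \<Longrightarrow> \<beta> < \<alpha> \<Longrightarrow> run b \<beta> = run b' \<beta>"
proof (induction \<beta> rule: less_induct)
  case (less \<beta>)
  have "next_round (run b) \<beta> = next_round (run b') \<beta>"
    by (rule history_cong) (use less in auto)
  then show ?case
    using less.prems by (simp add: run_unfold[of b] run_unfold[of b'] agree_def)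
qed

lemma node_cong: "agree \<alpha> b b' \<Longrightarrow> node b \<alpha> = node b' \<alpha>"
  unfolding node_def by (rule history_cong) (rule run_cong)

lemma piece_cong: "agree \<alpha> b b' \<Longrightarrow> piece (run b) \<alpha> = piece (run b') \<alpha>"
  by (rule history_cong) (rule run_cong)

lemma chosen_run: "chosen (run b) \<alpha> = piece (run b) \<alpha> (b \<alpha>)"
  by (simp add: chosen_def run_unfold[of b \<alpha>] next_round_def Let_def)

lemma node_eq: "node b \<alpha> = topspace X \<inter> (\<Inter>\<beta>\<in>{..<\<alpha>}. piece (run b) \<beta> (b \<beta>))"
  by (simp add: node_def cell_def game_arena_def chosen_run)

lemma pieces_disjoint: "y \<in> piece h \<alpha> i \<Longrightarrow> y \<in> piece h \<alpha> j \<Longrightarrow> i = j"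
  by (rule linorder_cases[of i j]) (auto simp: piece_def)

lemma run_follows_strategy:
  "II_moves (run b) \<alpha> = \<sigma> \<alpha> (restrict (I_moves (run b)) {..\<alpha>}) (restrict (II_moves (run b)) {..<\<alpha>})"
proof -
  define x where "x = (SOME x. fits (run b) \<alpha> (b \<alpha>) x)"
  have "I_moves (run b) \<alpha> = I_move (run b) \<alpha> x" "II_moves (run b) \<alpha> = reply (run b) \<alpha> x"
    by (simp_all add: I_moves_def II_moves_def run_unfold[of b \<alpha>] next_round_def x_def Let_def)
  then show ?thesis
    by (metis fun_upd_triv reply_def)
qed

text \<open>
  The invariant along a branch as long as its cells are nonempty.
\<close>

definition sound_below :: "('k, 'x) history \<Rightarrow> 'k \<Rightarrow> bool" where
  "sound_below h \<alpha> \<longleftrightarrow> (\<forall>\<beta><\<alpha>. legal_I X (I_moves h) (II_moves h) \<beta> \<and>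
     openin X (chosen h \<beta>) \<and> chosen h \<beta> \<subseteq> II_moves h \<beta> \<and>
     II_moves h \<beta> = \<sigma> \<beta> (restrict (I_moves h) {..\<beta>}) (restrict (II_moves h) {..<\<beta>}))"

text \<open>
  The run recorded in a sound history can be continued in round \<open>\<alpha>\<close> at any point \<open>x\<close> of the cell,
  not only at the point that the history itself takes. The reply is first of all relatively open
  in the arena, which need not be open; it is open because it is contained in the cell.
\<close>

lemma
  assumes sound: "sound_below h \<alpha>" and x: "x \<in> cell h \<alpha>"
  shows cell_open: "openin X (cell h \<alpha>)"
    and I_move_legal: "openin (subtopology X (game_arena X (II_moves h) \<alpha>)) (fst (I_move h \<alpha> x))"
      "x \<in> fst (I_move h \<alpha> x)"
    and reply_open: "openin X (reply h \<alpha> x)"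
    and in_reply: "x \<in> reply h \<alpha> x"
    and reply_subset: "reply h \<alpha> x \<subseteq> cell h \<alpha> \<inter> side \<alpha> x"
proof -
  show C_open: "openin X (cell h \<alpha>)"
    unfolding cell_def using sound by (intro openin_Inter_below[OF additive]) (simp add: sound_below_def)
  have C_arena: "cell h \<alpha> \<subseteq> game_arena X (II_moves h) \<alpha>"
    using sound by (auto simp: cell_def game_arena_def sound_below_def)
  have xX: "x \<in> topspace X"
    using x by (simp add: cell_def game_arena_def)
  have "openin X (side \<alpha> x)"
    using Z_open Z_closed by (auto simp: side_def)
  then have "openin X (cell h \<alpha> \<inter> side \<alpha> x)"
    using C_open by blast
  moreover have "cell h \<alpha> \<inter> side \<alpha> x = (cell h \<alpha> \<inter> side \<alpha> x) \<inter> game_arena X (II_moves h) \<alpha>"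
    using C_arena by blast
  ultimately show legal1: "openin (subtopology X (game_arena X (II_moves h) \<alpha>)) (fst (I_move h \<alpha> x))"
    unfolding I_move_def fst_conv openin_subtopology by blast
  show legal2: "x \<in> fst (I_move h \<alpha> x)"
    using x xX by (simp add: I_move_def side_def)
  define p where "p = (I_moves h)(\<alpha> := I_move h \<alpha> x)"
  define V where "V = (II_moves h)(\<alpha> := reply h \<alpha> x)"
  have arena: "game_arena X V \<beta> = game_arena X (II_moves h) \<beta>" if "\<beta> \<le> \<alpha>" for \<beta>
    using that by (auto simp: game_arena_def V_def)
  have restr: "restrict V {..<\<beta>} = restrict (II_moves h) {..<\<beta>}" if "\<beta> \<le> \<alpha>" for \<beta>
    using that by (intro restrict_ext) (auto simp: V_def)
  have p_below: "restrict p {..\<beta>} = restrict (I_moves h) {..\<beta>}" if "\<beta> < \<alpha>" for \<beta>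
    using that by (intro restrict_ext) (auto simp: p_def)
  have "legal_II X p V \<alpha>"
  proof (rule legal_II_if_partial_run[OF winning])
    fix \<beta> assume \<beta>: "\<beta> \<le> \<alpha>"
    show "V \<beta> = \<sigma> \<beta> (restrict p {..\<beta>}) (restrict V {..<\<beta>})"
    proof (cases "\<beta> = \<alpha>")
      case True
      then show ?thesis
        by (simp add: restr) (simp add: V_def p_def reply_def)
    next
      case False
      with \<beta> have "\<beta> < \<alpha>"
        by simp
      with sound False show ?thesis
        by (simp add: restr p_below V_def sound_below_def)
    qed
    show "legal_I X p V \<beta>"
    proof (cases "\<beta> = \<alpha>")
      case True
      then show ?thesis
        using legal1 legal2 by (simp add: legal_I_def arena) (simp add: p_def I_move_def)
    next
      case False
      with \<beta> have "\<beta> < \<alpha>"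
        by simp
      with sound False show ?thesis
        by (simp add: legal_I_def arena p_def sound_below_def)
    qed
  qed
  then have II: "openin (subtopology X (game_arena X (II_moves h) \<alpha>)) (reply h \<alpha> x)"
    "x \<in> reply h \<alpha> x" "reply h \<alpha> x \<subseteq> cell h \<alpha> \<inter> side \<alpha> x"
    using arena[of \<alpha>] by (simp_all add: legal_II_def p_def V_def I_move_def)
  then show "x \<in> reply h \<alpha> x" "reply h \<alpha> x \<subseteq> cell h \<alpha> \<inter> side \<alpha> x"
    by simp_all
  obtain T where "openin X T" "reply h \<alpha> x = T \<inter> game_arena X (II_moves h) \<alpha>"
    using II(1) by (auto simp: openin_subtopology)
  moreover from this have "reply h \<alpha> x = T \<inter> cell h \<alpha>"
    using II(3) C_arena by blast
  ultimately show "openin X (reply h \<alpha> x)"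
    using C_open by (metis openin_Int)
qed

lemma piece_open:
  assumes "openin X (cell h \<alpha>)"
  shows "openin X (piece h \<alpha> i)"
proof (cases "\<exists>x. fits h \<alpha> i x")
  case True
  define N where "N j = (if \<exists>x. fits h \<alpha> j x then topspace X - Z j else topspace X)" for j
  have "openin X (game_arena X N i)"
    by (rule openin_Inter_below[OF additive]) (use Z_closed in \<open>auto simp: N_def\<close>)
  then have "openin X (cell h \<alpha> \<inter> Z i \<inter> game_arena X N i)"
    using assms Z_open by blast
  moreover have "piece h \<alpha> i = cell h \<alpha> \<inter> Z i \<inter> game_arena X N i"
    using True openin_subset[OF assms] by (auto simp: piece_def game_arena_def N_def split: if_splits)
  ultimately show ?thesis
    by simp
next
  case False
  then have "piece h \<alpha> i = {}"
    by (simp add: piece_def)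
  then show ?thesis
    by simp
qed

lemma run_round:
  assumes sound: "sound_below (run b) \<alpha>" and alive: "y \<in> chosen (run b) \<alpha>"
  shows "legal_I X (I_moves (run b)) (II_moves (run b)) \<alpha>"
    "openin X (chosen (run b) \<alpha>)" "chosen (run b) \<alpha> \<subseteq> II_moves (run b) \<alpha>"
    "\<exists>x. II_moves (run b) \<alpha> \<subseteq> node b \<alpha> \<inter> side \<alpha> x"
proof -
  define x where "x = (SOME x. fits (run b) \<alpha> (b \<alpha>) x)"
  have "\<exists>x. fits (run b) \<alpha> (b \<alpha>) x"
    using alive by (auto simp: chosen_run piece_def)
  then have fits: "fits (run b) \<alpha> (b \<alpha>) x"
    unfolding x_def by (rule someI_ex)
  then have x: "x \<in> cell (run b) \<alpha>"
    by (simp add: fits_def)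
  have I: "I_moves (run b) \<alpha> = I_move (run b) \<alpha> x" and II: "II_moves (run b) \<alpha> = reply (run b) \<alpha> x"
    by (simp_all add: I_moves_def II_moves_def run_unfold[of b \<alpha>] next_round_def x_def Let_def)
  show "legal_I X (I_moves (run b)) (II_moves (run b)) \<alpha>"
    using I_move_legal[OF sound x] by (simp add: legal_I_def I) (simp add: I_move_def)
  show "openin X (chosen (run b) \<alpha>)"
    unfolding chosen_run by (rule piece_open[OF cell_open[OF sound x]])
  show "chosen (run b) \<alpha> \<subseteq> II_moves (run b) \<alpha>"
    using fits by (auto simp: chosen_run II piece_def fits_def)
  show "\<exists>x. II_moves (run b) \<alpha> \<subseteq> node b \<alpha> \<inter> side \<alpha> x"
    using reply_subset[OF sound x] by (auto simp: II node_def)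
qed

text \<open>
  A nonempty cell at \<open>\<alpha>\<close> has only nonempty pieces chosen before it, so that none of these rounds used
  an arbitrary choice.
\<close>

lemma node_nonempty_imp_sound:
  assumes "y \<in> node b \<alpha>"
  shows "sound_below (run b) \<alpha>"
proof -
  have "sound_below (run b) \<beta>" if "\<beta> \<le> \<alpha>" for \<beta>
    using that
  proof (induction \<beta> rule: less_induct)
    case (less \<beta>)
    show ?case
      unfolding sound_below_def
    proof (intro allI impI)
      fix \<gamma> assume \<gamma>: "\<gamma> < \<beta>"
      have "sound_below (run b) \<gamma>"
        using less \<gamma> by simp
      moreover have "y \<in> chosen (run b) \<gamma>"
        using assms \<gamma> less.prems by (auto simp: node_def cell_def game_arena_def)
      ultimately show "legal_I X (I_moves (run b)) (II_moves (run b)) \<gamma> \<and>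
          openin X (chosen (run b) \<gamma>) \<and> chosen (run b) \<gamma> \<subseteq> II_moves (run b) \<gamma> \<and>
          II_moves (run b) \<gamma> =
            \<sigma> \<gamma> (restrict (I_moves (run b)) {..\<gamma>}) (restrict (II_moves (run b)) {..<\<gamma>})"
        using run_round run_follows_strategy by blast
    qed
  qed
  then show ?thesis
    by simp
qed

lemma node_open: "y \<in> node b \<alpha> \<Longrightarrow> openin X (node b \<alpha>)"
  using cell_open node_nonempty_imp_sound unfolding node_def by blast

lemma pieces_cover:
  assumes "y \<in> node b \<alpha>"
  shows "\<exists>i. y \<in> piece (run b) \<alpha> i"
proof -
  have sound: "sound_below (run b) \<alpha>"
    using node_nonempty_imp_sound[OF assms] .
  have y: "y \<in> cell (run b) \<alpha>"
    using assms by (simp add: node_def)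
  obtain i where "y \<in> Z i" "Z i \<subseteq> reply (run b) \<alpha> y"
    using Z_base[OF reply_open[OF sound y] in_reply[OF sound y]] by blast
  then have ex: "\<exists>i. y \<in> Z i \<and> (\<exists>x. fits (run b) \<alpha> i x)"
    using y by (auto simp: fits_def)
  define i where "i = (LEAST i. y \<in> Z i \<and> (\<exists>x. fits (run b) \<alpha> i x))"
  have "y \<in> Z i \<and> (\<exists>x. fits (run b) \<alpha> i x)"
    unfolding i_def using ex by (rule LeastI_ex)
  moreover have "\<not> (y \<in> Z j \<and> (\<exists>x. fits (run b) \<alpha> j x))" if "j < i" for j
    using that unfolding i_def by (rule not_less_Least)
  ultimately have "y \<in> piece (run b) \<alpha> i"
    using y unfolding piece_def by blast
  then show ?thesis ..
qed

text \<open>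
  The branch is built by recursion: in round \<open>\<alpha>\<close> it takes the piece that contains \<open>y\<close>, provided that \<open>y\<close> is
  still in the cell. The proviso makes the recursion total; it always holds, because a cell is the
  intersection of the pieces before it.
\<close>

lemma branch_through:
  assumes "y \<in> topspace X"
  shows "\<exists>b. \<forall>\<alpha>. y \<in> node b \<alpha>"
proof -
  have "\<exists>b. \<forall>\<alpha>. y \<in> node b \<alpha> \<longrightarrow> y \<in> piece (run b) \<alpha> (b \<alpha>)"
  proof (rule dependent_wellorder_choice)
    fix r :: 'k and f g :: "'k \<Rightarrow> 'k" and \<alpha> assume "\<And>\<beta>. \<beta> < \<alpha> \<Longrightarrow> f \<beta> = g \<beta>"
    then have "agree \<alpha> f g"
      by (simp add: agree_def)
    then show "(y \<in> node f \<alpha> \<longrightarrow> y \<in> piece (run f) \<alpha> r) = (y \<in> node g \<alpha> \<longrightarrow> y \<in> piece (run g) \<alpha> r)"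
      using node_cong piece_cong by metis
  next
    fix \<alpha> f
    show "\<exists>r. y \<in> node f \<alpha> \<longrightarrow> y \<in> piece (run f) \<alpha> r"
      using pieces_cover by blast
  qed
  then obtain b where b: "\<And>\<alpha>. y \<in> node b \<alpha> \<Longrightarrow> y \<in> piece (run b) \<alpha> (b \<alpha>)"
    by blast
  have "y \<in> node b \<alpha>" for \<alpha>
  proof (induction \<alpha> rule: less_induct)
    case (less \<alpha>)
    then show ?case
      using b assms by (auto simp: node_eq)
  qed
  then show ?thesis
    by blast
qed

text \<open>
  At the first difference the partitions are still the same, and \<open>y\<close> is in only one of their pieces.
\<close>

lemma branch_unique:
  assumes "y \<in> node b \<alpha>" "y \<in> node b' \<alpha>"
  shows "agree \<alpha> b b'"
proof -
  have "b \<beta> = b' \<beta>" if "\<beta> < \<alpha>" for \<beta>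
    using that
  proof (induction \<beta> rule: less_induct)
    case (less \<beta>)
    then have "agree \<beta> b b'"
      by (simp add: agree_def)
    then have "piece (run b) \<beta> = piece (run b') \<beta>"
      by (rule piece_cong)
    moreover have "y \<in> piece (run b) \<beta> (b \<beta>)" "y \<in> piece (run b') \<beta> (b' \<beta>)"
      using assms less.prems by (auto simp: node_eq)
    ultimately show ?case
      using pieces_disjoint by metis
  qed
  then show ?thesis
    by (simp add: agree_def)
qed

lemma node_decides:
  assumes "y \<in> node b \<beta>" "\<alpha> < \<beta>" "y \<in> Z \<alpha>"
  shows "node b \<beta> \<subseteq> Z \<alpha>"
proof -
  have "y \<in> node b \<alpha>" and y: "y \<in> chosen (run b) \<alpha>"
    using assms(1,2) by (auto simp: node_eq chosen_run)
  then have sound: "sound_below (run b) \<alpha>"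
    using node_nonempty_imp_sound by blast
  obtain x where "chosen (run b) \<alpha> \<subseteq> side \<alpha> x"
    using run_round(3,4)[OF sound y] by blast
  with y assms(3) have "chosen (run b) \<alpha> \<subseteq> Z \<alpha>"
    by (auto simp: side_def split: if_splits)
  then show ?thesis
    using assms(2) by (auto simp: node_eq chosen_run)
qed

text \<open>
  The winning condition enters here. The arenas contain the cells, so the run is not ended at a limit and
  II wins it with a point in all replies. The reply in round \<open>\<alpha>\<close> is contained in the cell of round \<open>\<alpha>\<close>.
\<close>

lemma full_branch_nonempty:
  assumes alive: "\<And>\<alpha>. node b \<alpha> \<noteq> {}"
  shows "\<exists>y. \<forall>\<alpha>. y \<in> node b \<alpha>"
proof -
  let ?p = "I_moves (run b)" and ?V = "II_moves (run b)"
  have sound: "sound_below (run b) \<alpha>" for \<alpha>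
    using alive[of \<alpha>] node_nonempty_imp_sound by blast
  then have arena: "node b \<alpha> \<subseteq> game_arena X ?V \<alpha>" for \<alpha>
    by (force simp: node_def cell_def game_arena_def sound_below_def)
  then have not_ended: "\<not> ended_by X ?V \<alpha>" for \<alpha>
    using alive by (fastforce simp: ended_by_def)
  have "legal_I X ?p ?V \<alpha>" for \<alpha>
    using sound above[of \<alpha>] by (auto simp: sound_below_def)
  then have "II_wins X ?V"
    using winning run_follows_strategy[of b] unfolding winning_strategy_II_def by blast
  then obtain y where y: "\<And>\<alpha>. y \<in> ?V \<alpha>"
    using not_ended by (auto simp: II_wins_def)
  have "y \<in> node b \<alpha>" for \<alpha>
  proof -
    obtain \<beta> where "\<alpha> < \<beta>"
      using above by blast
    then obtain z where "z \<in> chosen (run b) \<alpha>"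
      using alive[of \<beta>] by (auto simp: node_eq chosen_run)
    from run_round(4)[OF sound this] show ?thesis
      using y by blast
  qed
  then show ?thesis
    by blast
qed

lemma branch_point_unique:
  assumes "\<And>\<alpha>. y \<in> node b \<alpha>" "\<And>\<alpha>. z \<in> node b \<alpha>"
  shows "y = z"
proof (rule ccontr)
  assume "y \<noteq> z"
  moreover have "y \<in> topspace X" "z \<in> topspace X"
    using assms by (auto simp: node_eq)
  ultimately obtain U where U: "openin X U" "y \<in> U" "z \<notin> U"
    using Hausdorff unfolding Hausdorff_space_def disjnt_iff by metis
  then obtain \<alpha> where "y \<in> Z \<alpha>" "Z \<alpha> \<subseteq> U"
    using Z_base by blast
  moreover obtain \<beta> where "\<alpha> < \<beta>"
    using above by blast
  ultimately show False
    using node_decides[OF assms(1)] assms(2) U(3) by blast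
qed

text \<open>
  Each point is mapped to its branch. The image consists of the branches all of whose cells are
  nonempty, and this set is closed because the cell at \<open>\<alpha>\<close> depends only on the restriction of the
  branch to \<open>\<alpha>\<close>.
\<close>

lemma closed_embedding_of_branches:
  "\<exists>f :: 'x \<Rightarrow> 'k \<Rightarrow> 'k. embedding_map X bounded_topology f \<and>
     closedin bounded_topology (f ` topspace X)"
proof -
  obtain f where f: "\<And>y \<alpha>. y \<in> topspace X \<Longrightarrow> y \<in> node (f y) \<alpha>"
    using branch_through by metis
  have "embedding_map X bounded_topology f"
    unfolding embedding_map_bounded_iff
  proof (intro conjI ballI allI impI; (elim conjE)?)
    show "inj_on f (topspace X)"
      using f branch_point_unique by (metis inj_onI)
  next
    fix y \<alpha> assume y: "y \<in> topspace X"
    have "agree \<alpha> (f y) (f z)" if "z \<in> node (f y) \<alpha>" for z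
    proof -
      have "z \<in> topspace X"
        using that by (simp add: node_eq)
      then show ?thesis
        using branch_unique[OF that] f by blast
    qed
    then show "\<exists>U. openin X U \<and> y \<in> U \<and> (\<forall>z\<in>U. agree \<alpha> (f y) (f z))"
      using node_open[OF f[OF y]] f[OF y] by blast
  next
    fix U y assume U: "openin X U" "y \<in> U"
    then obtain \<alpha> where \<alpha>: "y \<in> Z \<alpha>" "Z \<alpha> \<subseteq> U"
      using Z_base by blast
    obtain \<beta> where \<beta>: "\<alpha> < \<beta>"
      using above by blast
    have y: "y \<in> topspace X"
      using U openin_subset by blast
    have "z \<in> U" if z: "z \<in> topspace X" "agree \<beta> (f y) (f z)" for z
    proof -
      have "z \<in> node (f y) \<beta>"
        using node_cong[OF z(2)] f[OF z(1)] by simp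
      then show ?thesis
        using node_decides[OF f[OF y] \<beta> \<alpha>(1)] \<alpha>(2) by blast
    qed
    then show "\<exists>\<beta>. \<forall>z\<in>topspace X. agree \<beta> (f y) (f z) \<longrightarrow> z \<in> U"
      by blast
  qed
  moreover have "closedin bounded_topology (f ` topspace X)"
    unfolding closedin_bounded_iff
  proof (intro allI impI)
    fix b assume b: "\<forall>\<alpha>. \<exists>c\<in>f ` topspace X. agree \<alpha> b c"
    have "node b \<alpha> \<noteq> {}" for \<alpha>
    proof -
      obtain z where "z \<in> topspace X" "agree \<alpha> b (f z)"
        using b by blast
      then have "z \<in> node b \<alpha>"
        using f node_cong by blast
      then show ?thesis
        by blast
    qed
    then obtain y where y: "\<And>\<alpha>. y \<in> node b \<alpha>"
      using full_branch_nonempty by blast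
    then have yX: "y \<in> topspace X"
      by (simp add: node_eq)
    have "b \<beta> = f y \<beta>" for \<beta>
      using branch_unique[OF y f[OF yX]] above[of \<beta>] by (auto simp: agree_def)
    then have "b = f y"
      by blast
    with yX show "b \<in> f ` topspace X"
      by blast
  qed
  ultimately show ?thesis
    by blast
qed

end

context strong_cardinal
begin

lemma fSC_imp_closed_embedding:
  fixes X :: "'x topology"
  assumes "regular_space X" "Hausdorff_space X"
    and "additive_space (kappa :: 'k rel) X" "fSC_space k X"
  shows "\<exists>f :: 'x \<Rightarrow> 'k \<Rightarrow> 'k. embedding_map X bounded_topology f \<and>
    closedin bounded_topology (f ` topspace X)"
proof -
  obtain \<sigma> :: "'k \<Rightarrow> ('k \<Rightarrow> 'x set \<times> 'x) \<Rightarrow> ('k \<Rightarrow> 'x set) \<Rightarrow> 'x set"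
    where \<sigma>: "winning_strategy_II X \<sigma>" and weight: "weight_le X (kappa :: 'k rel)"
    using assms(4) by (auto simp: fSC_space_def)
  obtain Z :: "'k \<Rightarrow> 'x set" where Z: "(\<forall>i. openin X (Z i) \<and> closedin X (Z i)) \<and>
      (\<forall>U x. openin X U \<and> x \<in> U \<longrightarrow> (\<exists>i. x \<in> Z i \<and> Z i \<subseteq> U))"
    using enumerated_clopen_base[OF assms(3,1) weight] by (elim exE)
  interpret choquet_tree k X \<sigma> Z
    by unfold_locales (use assms \<sigma> Z in simp_all)
  show ?thesis
    by (rule closed_embedding_of_branches)
qed

end

section \<open>The equivalence\<close>

theorem theorem2p20:
  fixes X :: "'x topology"
  assumes "uncountable_regular_strong TYPE('k::wellorder)"
    and "has_Deg TYPE('g::linordered_ab_group_add) (kappa :: 'k rel)"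
    and "regular_space X" and "Hausdorff_space X"
  shows "(group_Polish TYPE('k) TYPE('g) X \<longleftrightarrow>
            additive_space (kappa :: 'k rel) X \<and> fSC_space TYPE('k) X) \<and>
         (additive_space (kappa :: 'k rel) X \<and> fSC_space TYPE('k) X \<longleftrightarrow>
            (\<exists>S. Gdelta_kappa TYPE('k) (bounded_topology :: ('k \<Rightarrow> 'k) topology) S \<and>
                 X homeomorphic_space subtopology bounded_topology S)) \<and>
         ((\<exists>S. Gdelta_kappa TYPE('k) (bounded_topology :: ('k \<Rightarrow> 'k) topology) S \<and>
               X homeomorphic_space subtopology bounded_topology S) \<longleftrightarrow>
            (\<exists>C. closedin (bounded_topology :: ('k \<Rightarrow> 'k) topology) C \<and>
                 X homeomorphic_space subtopology bounded_topology C))"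
proof -
  interpret deg_group "TYPE('k)" "TYPE('g)"
    using assms(1,2) by unfold_locales
  let ?Y = "bounded_topology :: ('k \<Rightarrow> 'k) topology"
  let ?Polish = "group_Polish TYPE('k) TYPE('g) X"
  let ?fSC = "additive_space (kappa :: 'k rel) X \<and> fSC_space TYPE('k) X"
  let ?Gdelta = "\<exists>S. Gdelta_kappa TYPE('k) ?Y S \<and> X homeomorphic_space subtopology ?Y S"
  let ?closed = "\<exists>C. closedin ?Y C \<and> X homeomorphic_space subtopology ?Y C"
  have closed_iff: "?closed \<longleftrightarrow>
      (\<exists>f. embedding_map X ?Y f \<and> closedin ?Y (f ` topspace X))"
    unfolding homeomorphic_subspace_bounded_iff by blast
  have Gdelta_iff: "?Gdelta \<longleftrightarrow>
      (\<exists>f. embedding_map X ?Y f \<and> Gdelta_kappa TYPE('k) ?Y (f ` topspace X))"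
    unfolding homeomorphic_subspace_bounded_iff by blast
  have "?Polish \<Longrightarrow> ?fSC"
    using group_Polish_imp_additive_fSC by blast
  moreover have "?fSC \<Longrightarrow> ?closed"
    using fSC_imp_closed_embedding[OF assms(3,4)] closed_iff by blast
  moreover have "?closed \<Longrightarrow> ?Gdelta"
    using closedin_bounded_imp_Gdelta by blast
  moreover have "?Gdelta \<Longrightarrow> ?closed"
    unfolding closed_iff Gdelta_iff using Gdelta_embedding_imp_closed_embedding by blast
  moreover have "?closed \<Longrightarrow> ?Polish"
    unfolding closed_iff using closed_embedding_imp_group_Polish by blast
  ultimately show ?thesis
    by argo
qed

end
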